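(* Let $\mathcal{A}=(\mathcal{A}_L,\mathcal{A}_R,S)$ be a Hopf algebroid over a commutative ring $k$, with $\mathcal{A}_L=(A,L,s_L,t_L,\gamma_L,\pi_L)$ and $\mathcal{A}_R=(A,R,s_R,t_R,\gamma_R,\pi_R)$, such that all of the modules $A^R$, ${}^RA$, ${}_LA$ and $A_L$ are finitely generated and projective. The following statements are equivalent: 1) The antipode $S$ is bijective. 2) There exists an invariant $\sum_kx_k\otimes\lambda_k^*$, with respect to $\mathcal{A}_L$, of the left $A$-module ${}^RA\otimes\mathcal{L}(\mathcal{A}^* )^R$ (defined via left multiplication in the first factor), satisfying in addition $\sum_k\lambda_k^*(x_k)=1_R$. Here the right $R$-module structure of $\mathcal{L}(\mathcal{A}^* )^R$ is $\lambda^*\cdot r:=\lambda^*(-\,t_R(r))$.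
   Context: Algebras are associative unital algebras over a commutative ring $k$. **Left bialgebroid.** A left bialgebroid $(A,L,s,t,\gamma,\pi)$ consists of $k$-algebras $A$ (total) and $L$ (base), algebra homomorphisms $s:L\to A$ and $t:L^{op}\to A$ with commuting ranges, and an $L$-coring structure (coassociative coproduct $\gamma:A\to A\otimes_L A$ and counit $\pi:A\to L$, both $L$-$L$ bimodule maps) on the $L$-$L$ bimodule $A$ with actions $l\cdot a\cdot l'=s(l)t(l')a$. Writing $\gamma(a)=a_{(1)}\otimes a_{(2)}$, it is required that $a_{(1)}t(l)\otimes a_{(2)}=a_{(1)}\otimes a_{(2)}s(l)$, $\gamma(1)=1\otimes 1$, $\gamma(aa')=\gamma(a)\gamma(a')$, $\pi(1)=1$, $\pi(a\,s(\pi(a')))=\pi(aa')=\pi(a\,t(\pi(a')))$. **Right bialgebroid.** $(A,R,s,t,\gamma,\pi)$ is a right bialgebroid if $(A^{op},R,t,s,\gamma,\pi)$ is a left bialgebroid. Explicitly: $s:R\to A$, $t:R^{op}\to A$ are algebra maps with commuting ranges; $(A,\gamma,\pi)$ is an $R$-coring for the bimodule $r\cdot a\cdot r'=a\,s(r')t(r)$; and, with $\gamma(a)=a^{(1)}\otimes a^{(2)}$: $s(r)a^{(1)}\otimes a^{(2)}=a^{(1)}\otimes t(r)a^{(2)}$, $\gamma(1)=1\otimes1$, $\gamma(aa')=\gamma(a)\gamma(a')$, $\pi(1)=1$, $\pi(s(\pi(a))a')=\pi(aa')=\pi(t(\pi(a))a')$. **Module notation.** For $B\in\{L,R\}$ with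 $s=s_B,t=t_B$: ${}_BA$ is $A$ with left action $b\cdot a=s(b)a$; $A_B$ has right action $a\cdot b=t(b)a$; $A^B$ has right action $a\cdot b=a\,s(b)$; ${}^BA$ has left action $b\cdot a=a\,t(b)$. In a tensor product the displayed module structures are the ones balanced over $B$ (or $B^{op}$), e.g. $A_L\otimes{}_LA$ has $t_L(l)a\otimes b=a\otimes s_L(l)b$, $A^R\otimes{}^RA$ has $as_R(r)\otimes b=a\otimes bt_R(r)$, and ${}^RA\otimes\mathcal{L}(\mathcal{A}^* )^R$ has $x\,t_R(r)\otimes\lambda^*=x\otimes\lambda^*(-\,t_R(r))$. **Hopf algebroid.** $\mathcal{A}=(\mathcal{A}_L,\mathcal{A}_R,S)$ consists of a left bialgebroid $\mathcal{A}_L=(A,L,s_L,t_L,\gamma_L,\pi_L)$ and a right bialgebroid $\mathcal{A}_R=(A,R,s_R,t_R,\gamma_R,\pi_R)$ on the same total algebra $A$ and a $k$-linear map $S:A\to A$ (antipode, not assumed bijective) such that (i) $s_L\pi_Lt_R=t_R$, $t_L\pi_Ls_R=s_R$, $s_R\pi_Rt_L=t_L$, $t_R\pi_Rs_L=s_L$; (ii) $(\gamma_L\otimes{}^RA)\gamma_R=(A_L\otimes\gamma_R)\gamma_L$ as maps $A\to A_L\otimes{}_LA^R\otimes{}^RA$, and $(\gamma_R\otimes{}_LA)\gamma_L=(A^R\otimes\gamma_L)\gamma_R$ as maps $A\to A^R\otimes{}^RA_L\otimes{}_LA$; (iii) $S(t_L(l')\,a\,t_L(l))=s_L(l)S(a)s_L(l')$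 and $S(t_R(r')\,a\,t_R(r))=s_R(r)S(a)s_R(r')$; (iv) $S(a_{(1)})a_{(2)}=s_R\pi_R(a)$ and $a^{(1)}S(a^{(2)})=s_L\pi_L(a)$, where $\gamma_L(a)=a_{(1)}\otimes a_{(2)}$ and $\gamma_R(a)=a^{(1)}\otimes a^{(2)}$. **Left $s$-integrals on $\mathcal{A}$.** With $\mathcal{A}^*=\mathrm{Hom}_R(A^R,R)$, $\mathcal{L}(\mathcal{A}^* )=\{\lambda^*\in\mathcal{A}^*\mid a^{(2)}t_R(\lambda^*(a^{(1)}))=s_R(\lambda^*(a))\ \forall a\in A\}$. The notation $\lambda^*(-\,a)$ means $b\mapsto\lambda^*(ba)$. **Invariants.** The invariants of a left $A$-module $M$ with respect to $\mathcal{A}_L$ are the elements $n\in M$ with $a\cdot n=s_L(\pi_L(a))\cdot n$ for all $a\in A$. *)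

theory Defs
  imports
    "HOL-Library.Poly_Mapping"
    "HOL-Library.Function_Algebras"
    "HOL-Computational_Algebra.Group_Closure"
begin

text \<open>
  Rings are types of sort \<open>{ring, monoid_mult}\<close>, i.e. associative unital rings in which \<open>1 = 0\<close> is
  not excluded (\<open>ring_1\<close> would exclude the zero ring).
\<close>

section \<open>Algebras\<close>

locale unital_algebra =
  fixes scale :: "'k::{comm_ring,comm_monoid_mult} \<Rightarrow> 'a::{ring,monoid_mult} \<Rightarrow> 'a"
  assumes scale_right_distrib: "scale c (x + y) = scale c x + scale c y"
    and scale_left_distrib: "scale (c + d) x = scale c x + scale d x"
    and scale_scale: "scale c (scale d x) = scale (c * d) x"
    and scale_one: "scale 1 x = x"
    and scale_mult_left: "scale c x * y = scale c (x * y)"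
    and scale_mult_right: "x * scale c y = scale c (x * y)"

definition linear_map :: "('k \<Rightarrow> 'a \<Rightarrow> 'a) \<Rightarrow> ('k \<Rightarrow> 'b \<Rightarrow> 'b) \<Rightarrow> ('a::plus \<Rightarrow> 'b::plus) \<Rightarrow> bool" where
  "linear_map sm sm' f \<longleftrightarrow>
     (\<forall>x y. f (x + y) = f x + f y) \<and> (\<forall>c x. f (sm c x) = sm' c (f x))"

definition algebra_hom :: "('k \<Rightarrow> 'a \<Rightarrow> 'a) \<Rightarrow> ('k \<Rightarrow> 'b \<Rightarrow> 'b)
    \<Rightarrow> ('a::{ring,monoid_mult} \<Rightarrow> 'b::{ring,monoid_mult}) \<Rightarrow> bool" where
  "algebra_hom sm sm' f \<longleftrightarrow>
     linear_map sm sm' f \<and> f 1 = 1 \<and> (\<forall>x y. f (x * y) = f x * f y)"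

text \<open>An algebra homomorphism from the opposite algebra of \<open>'a\<close> to \<open>'b\<close>.\<close>

definition algebra_antihom :: "('k \<Rightarrow> 'a \<Rightarrow> 'a) \<Rightarrow> ('k \<Rightarrow> 'b \<Rightarrow> 'b)
    \<Rightarrow> ('a::{ring,monoid_mult} \<Rightarrow> 'b::{ring,monoid_mult}) \<Rightarrow> bool" where
  "algebra_antihom sm sm' f \<longleftrightarrow>
     linear_map sm sm' f \<and> f 1 = 1 \<and> (\<forall>x y. f (x * y) = f y * f x)"


section \<open>Module structures on the total algebra\<close>

text \<open>
  With \<open>s\<close>, \<open>t\<close> the source and target maps of a base \<open>B\<close>, the four \<open>B\<close>-module structures on \<open>A\<close> are
  \<open>via_left s\<close> (\<open>\<^sub>BA\<close>, left), \<open>via_left t\<close> (\<open>A\<^sub>B\<close>, right), \<open>via_right s\<close> (\<open>A\<^sup>B\<close>, right) and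
  \<open>via_right t\<close> (\<open>\<^sup>BA\<close>, left). Right actions \<open>m \<cdot> b\<close> also take the scalar first: \<open>act b m\<close>.
\<close>

definition via_left :: "('b \<Rightarrow> 'a::times) \<Rightarrow> 'b \<Rightarrow> 'a \<Rightarrow> 'a" where
  "via_left f b a = f b * a"

definition via_right :: "('b \<Rightarrow> 'a::times) \<Rightarrow> 'b \<Rightarrow> 'a \<Rightarrow> 'a" where
  "via_right f b a = a * f b"

text \<open>
  In the next definitions \<open>reg\<close> is the regular action of the base ring on itself: \<open>(*)\<close> for left
  modules, \<open>\<lambda>b x. x * b\<close> for right modules.
\<close>

definition finitely_generated :: "('b \<Rightarrow> 'm::ab_group_add \<Rightarrow> 'm) \<Rightarrow> bool" where
  "finitely_generated act \<longleftrightarrow>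
     (\<exists>X. finite X \<and> (\<forall>m. \<exists>c. m = (\<Sum>x\<in>X. act (c x) x)))"

text \<open>
  Projectivity: being a direct summand of a free module. The free module on a set \<open>I\<close> consists of
  the finitely supported maps with support in \<open>I\<close>. It is enough to let \<open>I\<close> range over sets of
  elements of the module, since a direct summand of any free module is a direct summand of the
  free module on its own underlying set.
\<close>

definition projective ::
    "('b::{ring,monoid_mult} \<Rightarrow> 'b \<Rightarrow> 'b) \<Rightarrow> ('b \<Rightarrow> 'm::ab_group_add \<Rightarrow> 'm) \<Rightarrow> bool" where
  "projective reg act \<longleftrightarrow>
     (\<exists>(I :: 'm set) (i :: 'm \<Rightarrow> 'm \<Rightarrow>\<^sub>0 'b) (p :: ('m \<Rightarrow>\<^sub>0 'b) \<Rightarrow> 'm).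
        (\<forall>m. Poly_Mapping.keys (i m) \<subseteq> I) \<and>
        (\<forall>m m'. i (m + m') = i m + i m') \<and>
        (\<forall>b m. i (act b m) = Poly_Mapping.map (reg b) (i m)) \<and>
        (\<forall>f g. Poly_Mapping.keys f \<subseteq> I \<longrightarrow> Poly_Mapping.keys g \<subseteq> I \<longrightarrow> p (f + g) = p f + p g) \<and>
        (\<forall>b f. Poly_Mapping.keys f \<subseteq> I \<longrightarrow> p (Poly_Mapping.map (reg b) f) = act b (p f)) \<and>
        (\<forall>m. p (i m) = m))"

definition fg_projective_left ::
    "('b::{ring,monoid_mult} \<Rightarrow> 'm::ab_group_add \<Rightarrow> 'm) \<Rightarrow> bool" where
  "fg_projective_left act \<longleftrightarrow> finitely_generated act \<and> projective (\<lambda>b x. b * x) act"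

definition fg_projective_right ::
    "('b::{ring,monoid_mult} \<Rightarrow> 'm::ab_group_add \<Rightarrow> 'm) \<Rightarrow> bool" where
  "fg_projective_right act \<longleftrightarrow> finitely_generated act \<and> projective (\<lambda>b x. x * b) act"


section \<open>Tensor products\<close>

text \<open>
  \<open>M \<otimes> N\<close> is the quotient of the free abelian group on \<open>M \<times> N\<close> by the subgroup \<open>tensor_null\<close>
  generated by the biadditivity and balancing relators; its elements are cosets.
  The balancing relation is \<open>f b m \<otimes> n = m \<otimes> g b n\<close>.
\<close>

definition tensor_null :: "'m::plus set \<Rightarrow> 'n::plus set \<Rightarrow> ('b \<Rightarrow> 'm \<Rightarrow> 'm) \<Rightarrow> ('b \<Rightarrow> 'n \<Rightarrow> 'n)
    \<Rightarrow> ('m \<times> 'n \<Rightarrow>\<^sub>0 int) set" where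
  "tensor_null M N f g = group_closure
     ({frag_of (m + m', n) - frag_of (m, n) - frag_of (m', n) | m m' n. m \<in> M \<and> m' \<in> M \<and> n \<in> N} \<union>
      {frag_of (m, n + n') - frag_of (m, n) - frag_of (m, n') | m n n'. m \<in> M \<and> n \<in> N \<and> n' \<in> N} \<union>
      {frag_of (f b m, n) - frag_of (m, g b n) | b m n. m \<in> M \<and> n \<in> N})"

text \<open>
  The null subgroup of a threefold tensor product of the total algebra with itself, balanced by
  \<open>f b x \<otimes> y \<otimes> z = x \<otimes> g b y \<otimes> z\<close> and \<open>x \<otimes> h c y \<otimes> z = x \<otimes> y \<otimes> k c z\<close>.
\<close>

definition tensor3_null :: "('b \<Rightarrow> 'a \<Rightarrow> 'a) \<Rightarrow> ('b \<Rightarrow> 'a \<Rightarrow> 'a) \<Rightarrow> ('c \<Rightarrow> 'a \<Rightarrow> 'a) \<Rightarrow> ('c \<Rightarrow> 'a \<Rightarrow> 'a)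
    \<Rightarrow> ('a::plus \<times> 'a \<times> 'a \<Rightarrow>\<^sub>0 int) set" where
  "tensor3_null f g h k = group_closure
     ({frag_of (x + x', y, z) - frag_of (x, y, z) - frag_of (x', y, z) | x x' y z. True} \<union>
      {frag_of (x, y + y', z) - frag_of (x, y, z) - frag_of (x, y', z) | x y y' z. True} \<union>
      {frag_of (x, y, z + z') - frag_of (x, y, z) - frag_of (x, y, z') | x y z z'. True} \<union>
      {frag_of (f b x, y, z) - frag_of (x, g b y, z) | b x y z. True} \<union>
      {frag_of (x, h c y, z) - frag_of (x, y, k c z) | c x y z. True})"

definition coset :: "('p \<Rightarrow>\<^sub>0 int) set \<Rightarrow> ('p \<Rightarrow>\<^sub>0 int) \<Rightarrow> ('p \<Rightarrow>\<^sub>0 int) set" where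
  "coset K x = {y. y - x \<in> K}"

definition rep :: "('p \<Rightarrow>\<^sub>0 int) set \<Rightarrow> ('p \<Rightarrow>\<^sub>0 int)" where
  "rep X = (SOME x. x \<in> X)"

definition tensor :: "'m::plus set \<Rightarrow> 'n::plus set \<Rightarrow> ('b \<Rightarrow> 'm \<Rightarrow> 'm) \<Rightarrow> ('b \<Rightarrow> 'n \<Rightarrow> 'n)
    \<Rightarrow> ('m \<times> 'n \<Rightarrow>\<^sub>0 int) set set" where
  "tensor M N f g = coset (tensor_null M N f g) ` {x. Poly_Mapping.keys x \<subseteq> M \<times> N}"

definition tensor_add :: "('p \<Rightarrow>\<^sub>0 int) set \<Rightarrow> ('p \<Rightarrow>\<^sub>0 int) set \<Rightarrow> ('p \<Rightarrow>\<^sub>0 int) set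
    \<Rightarrow> ('p \<Rightarrow>\<^sub>0 int) set" where
  "tensor_add K X Y = coset K (rep X + rep Y)"

text \<open>
  Maps out of a tensor product are given on generators and extended additively along a
  representative. They are only used for assignments that respect the defining relations, so that
  the choice of the representative is irrelevant. Here \<open>K\<close> is the null subgroup of the codomain.
\<close>

definition induced :: "('q \<Rightarrow>\<^sub>0 int) set \<Rightarrow> ('p \<Rightarrow> ('q \<Rightarrow>\<^sub>0 int)) \<Rightarrow> ('p \<Rightarrow>\<^sub>0 int) set
    \<Rightarrow> ('q \<Rightarrow>\<^sub>0 int) set" where
  "induced K \<phi> X = coset K (frag_extend \<phi> (rep X))"

text \<open>\<open>f \<otimes> g\<close>\<close>

definition tensor_map :: "('p \<times> 'q \<Rightarrow>\<^sub>0 int) set \<Rightarrow> ('m \<Rightarrow> 'p) \<Rightarrow> ('n \<Rightarrow> 'q)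
    \<Rightarrow> ('m \<times> 'n \<Rightarrow>\<^sub>0 int) set \<Rightarrow> ('p \<times> 'q \<Rightarrow>\<^sub>0 int) set" where
  "tensor_map K f g = induced K (\<lambda>(m, n). frag_of (f m, g n))"

text \<open>The factorwise product \<open>(a \<otimes> b)(a' \<otimes> b') = aa' \<otimes> bb'\<close>.\<close>

definition tensor_mult :: "('a::times \<times> 'a \<Rightarrow>\<^sub>0 int) set \<Rightarrow> ('a \<times> 'a \<Rightarrow>\<^sub>0 int) set
    \<Rightarrow> ('a \<times> 'a \<Rightarrow>\<^sub>0 int) set \<Rightarrow> ('a \<times> 'a \<Rightarrow>\<^sub>0 int) set" where
  "tensor_mult K X Y =
     induced K (\<lambda>(a, b). frag_extend (\<lambda>(a', b'). frag_of (a * a', b * b')) (rep Y)) X"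

text \<open>\<open>\<gamma> \<otimes> A\<close> and \<open>A \<otimes> \<gamma>\<close>, with values in a threefold tensor product\<close>

definition coprod_fst :: "('a \<times> 'a \<times> 'a \<Rightarrow>\<^sub>0 int) set \<Rightarrow> ('a \<Rightarrow> ('a \<times> 'a \<Rightarrow>\<^sub>0 int) set)
    \<Rightarrow> ('a \<times> 'a \<Rightarrow>\<^sub>0 int) set \<Rightarrow> ('a \<times> 'a \<times> 'a \<Rightarrow>\<^sub>0 int) set" where
  "coprod_fst K \<gamma> =
     induced K (\<lambda>(b, c). frag_extend (\<lambda>(x, y). frag_of (x, y, c)) (rep (\<gamma> b)))"

definition coprod_snd :: "('a \<times> 'a \<times> 'a \<Rightarrow>\<^sub>0 int) set \<Rightarrow> ('a \<Rightarrow> ('a \<times> 'a \<Rightarrow>\<^sub>0 int) set)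
    \<Rightarrow> ('a \<times> 'a \<Rightarrow>\<^sub>0 int) set \<Rightarrow> ('a \<times> 'a \<times> 'a \<Rightarrow>\<^sub>0 int) set" where
  "coprod_snd K \<gamma> =
     induced K (\<lambda>(b, c). frag_extend (\<lambda>(x, y). frag_of (b, x, y)) (rep (\<gamma> c)))"

definition int_times :: "int \<Rightarrow> 'g::ab_group_add \<Rightarrow> 'g" where
  "int_times n g = (\<Sum>_<nat n. g) - (\<Sum>_<nat (- n). g)"

text \<open>\<open>\<Sum>\<^sub>k m\<^sub>k \<otimes> n\<^sub>k \<mapsto> \<Sum>\<^sub>k \<phi> m\<^sub>k n\<^sub>k\<close>, with values in an abelian group\<close>

definition tensor_eval :: "('m \<Rightarrow> 'n \<Rightarrow> 'g::ab_group_add) \<Rightarrow> ('m \<times> 'n \<Rightarrow>\<^sub>0 int) set \<Rightarrow> 'g" where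
  "tensor_eval \<phi> X =
     (\<Sum>(m, n)\<in>Poly_Mapping.keys (rep X). int_times (Poly_Mapping.lookup (rep X) (m, n)) (\<phi> m n))"


section \<open>Bialgebroids\<close>

text \<open>
  The square \<open>A\<^sub>L \<otimes> \<^sub>LA\<close>, with \<open>t l * a \<otimes> b = a \<otimes> s l * b\<close>, and the square \<open>A\<^sup>R \<otimes> \<^sup>RA\<close>, with
  \<open>a * s r \<otimes> b = a \<otimes> b * t r\<close>.
\<close>

abbreviation left_tensor_null ::
    "('l \<Rightarrow> 'a::{ring,monoid_mult}) \<Rightarrow> ('l \<Rightarrow> 'a) \<Rightarrow> ('a \<times> 'a \<Rightarrow>\<^sub>0 int) set" where
  "left_tensor_null s t \<equiv> tensor_null UNIV UNIV (via_left t) (via_left s)"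

abbreviation right_tensor_null ::
    "('r \<Rightarrow> 'a::{ring,monoid_mult}) \<Rightarrow> ('r \<Rightarrow> 'a) \<Rightarrow> ('a \<times> 'a \<Rightarrow>\<^sub>0 int) set" where
  "right_tensor_null s t \<equiv> tensor_null UNIV UNIV (via_right s) (via_right t)"

text \<open>
  The bimodule structure on the total algebra is \<open>l \<cdot> a \<cdot> l' = s l * t l' * a\<close>, hence on the square
  \<open>l \<cdot> (a \<otimes> b) \<cdot> l' = s l * a \<otimes> t l' * b\<close>.
\<close>

locale left_bialgebroid =
  total: unital_algebra scA + base: unital_algebra scL
  for scA :: "'k::{comm_ring,comm_monoid_mult} \<Rightarrow> 'a::{ring,monoid_mult} \<Rightarrow> 'a"
    and scL :: "'k \<Rightarrow> 'l::{ring,monoid_mult} \<Rightarrow> 'l" +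
  fixes s :: "'l \<Rightarrow> 'a"
    and t :: "'l \<Rightarrow> 'a"
    and \<gamma> :: "'a \<Rightarrow> ('a \<times> 'a \<Rightarrow>\<^sub>0 int) set"
    and \<pi> :: "'a \<Rightarrow> 'l"
  assumes source: "algebra_hom scL scA s"
    and target: "algebra_antihom scL scA t"
    and commuting_ranges: "s l * t l' = t l' * s l"
    and coprod_in_tensor: "\<gamma> a \<in> tensor UNIV UNIV (via_left t) (via_left s)"
    and coprod_add: "\<gamma> (a + a') = tensor_add (left_tensor_null s t) (\<gamma> a) (\<gamma> a')"
    and coprod_bimodule:
      "\<gamma> (s l * t l' * a) = tensor_map (left_tensor_null s t) (\<lambda>x. s l * x) (\<lambda>y. t l' * y) (\<gamma> a)"
    and counit_add: "\<pi> (a + a') = \<pi> a + \<pi> a'"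
    and counit_bimodule: "\<pi> (s l * t l' * a) = l * \<pi> a * l'"
    and coassoc:
      "coprod_fst (tensor3_null (via_left t) (via_left s) (via_left t) (via_left s)) \<gamma> (\<gamma> a) =
       coprod_snd (tensor3_null (via_left t) (via_left s) (via_left t) (via_left s)) \<gamma> (\<gamma> a)"
    and counit_left: "tensor_eval (\<lambda>x y. s (\<pi> x) * y) (\<gamma> a) = a"
    and counit_right: "tensor_eval (\<lambda>x y. t (\<pi> y) * x) (\<gamma> a) = a"
    and takeuchi:
      "tensor_map (left_tensor_null s t) (\<lambda>x. x * t l) (\<lambda>y. y) (\<gamma> a) =
       tensor_map (left_tensor_null s t) (\<lambda>x. x) (\<lambda>y. y * s l) (\<gamma> a)"
    and coprod_one: "\<gamma> 1 = coset (left_tensor_null s t) (frag_of (1, 1))"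
    and coprod_mult: "\<gamma> (a * a') = tensor_mult (left_tensor_null s t) (\<gamma> a) (\<gamma> a')"
    and counit_one: "\<pi> 1 = 1"
    and counit_source: "\<pi> (a * s (\<pi> a')) = \<pi> (a * a')"
    and counit_target: "\<pi> (a * t (\<pi> a')) = \<pi> (a * a')"

text \<open>
  These are the axioms of a left bialgebroid for the opposite total algebra with \<open>s\<close> and \<open>t\<close>
  interchanged. The bimodule structure on the total algebra is \<open>r \<cdot> a \<cdot> r' = a * s r' * t r\<close>, hence
  on the square \<open>r \<cdot> (a \<otimes> b) \<cdot> r' = a * t r \<otimes> b * s r'\<close>.
\<close>

locale right_bialgebroid =
  total: unital_algebra scA + base: unital_algebra scR
  for scA :: "'k::{comm_ring,comm_monoid_mult} \<Rightarrow> 'a::{ring,monoid_mult} \<Rightarrow> 'a"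
    and scR :: "'k \<Rightarrow> 'r::{ring,monoid_mult} \<Rightarrow> 'r" +
  fixes s :: "'r \<Rightarrow> 'a"
    and t :: "'r \<Rightarrow> 'a"
    and \<gamma> :: "'a \<Rightarrow> ('a \<times> 'a \<Rightarrow>\<^sub>0 int) set"
    and \<pi> :: "'a \<Rightarrow> 'r"
  assumes source: "algebra_hom scR scA s"
    and target: "algebra_antihom scR scA t"
    and commuting_ranges: "s r * t r' = t r' * s r"
    and coprod_in_tensor: "\<gamma> a \<in> tensor UNIV UNIV (via_right s) (via_right t)"
    and coprod_add: "\<gamma> (a + a') = tensor_add (right_tensor_null s t) (\<gamma> a) (\<gamma> a')"
    and coprod_bimodule:
      "\<gamma> (a * s r' * t r) = tensor_map (right_tensor_null s t) (\<lambda>x. x * t r) (\<lambda>y. y * s r') (\<gamma> a)"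
    and counit_add: "\<pi> (a + a') = \<pi> a + \<pi> a'"
    and counit_bimodule: "\<pi> (a * s r' * t r) = r * \<pi> a * r'"
    and coassoc:
      "coprod_fst (tensor3_null (via_right s) (via_right t) (via_right s) (via_right t)) \<gamma> (\<gamma> a) =
       coprod_snd (tensor3_null (via_right s) (via_right t) (via_right s) (via_right t)) \<gamma> (\<gamma> a)"
    and counit_left: "tensor_eval (\<lambda>x y. y * t (\<pi> x)) (\<gamma> a) = a"
    and counit_right: "tensor_eval (\<lambda>x y. x * s (\<pi> y)) (\<gamma> a) = a"
    and takeuchi:
      "tensor_map (right_tensor_null s t) (\<lambda>x. s r * x) (\<lambda>y. y) (\<gamma> a) =
       tensor_map (right_tensor_null s t) (\<lambda>x. x) (\<lambda>y. t r * y) (\<gamma> a)"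
    and coprod_one: "\<gamma> 1 = coset (right_tensor_null s t) (frag_of (1, 1))"
    and coprod_mult: "\<gamma> (a * a') = tensor_mult (right_tensor_null s t) (\<gamma> a) (\<gamma> a')"
    and counit_one: "\<pi> 1 = 1"
    and counit_source: "\<pi> (s (\<pi> a) * a') = \<pi> (a * a')"
    and counit_target: "\<pi> (t (\<pi> a) * a') = \<pi> (a * a')"


section \<open>Hopf algebroids, integrals and invariants\<close>

locale hopf_algebroid =
  left: left_bialgebroid scA scL s\<^sub>L t\<^sub>L \<gamma>\<^sub>L \<pi>\<^sub>L + right: right_bialgebroid scA scR s\<^sub>R t\<^sub>R \<gamma>\<^sub>R \<pi>\<^sub>R
  for scA :: "'k::{comm_ring,comm_monoid_mult} \<Rightarrow> 'a::{ring,monoid_mult} \<Rightarrow> 'a"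
    and scL :: "'k \<Rightarrow> 'l::{ring,monoid_mult} \<Rightarrow> 'l"
    and s\<^sub>L t\<^sub>L \<gamma>\<^sub>L \<pi>\<^sub>L
    and scR :: "'k \<Rightarrow> 'r::{ring,monoid_mult} \<Rightarrow> 'r"
    and s\<^sub>R t\<^sub>R \<gamma>\<^sub>R \<pi>\<^sub>R +
  fixes S :: "'a \<Rightarrow> 'a"
  assumes base_compat:
      "s\<^sub>L (\<pi>\<^sub>L (t\<^sub>R r)) = t\<^sub>R r"
      "t\<^sub>L (\<pi>\<^sub>L (s\<^sub>R r)) = s\<^sub>R r"
      "s\<^sub>R (\<pi>\<^sub>R (t\<^sub>L l)) = t\<^sub>L l"
      "t\<^sub>R (\<pi>\<^sub>R (s\<^sub>L l)) = s\<^sub>L l"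
    and mixed_coassoc:
      "coprod_fst (tensor3_null (via_left t\<^sub>L) (via_left s\<^sub>L) (via_right s\<^sub>R) (via_right t\<^sub>R)) \<gamma>\<^sub>L (\<gamma>\<^sub>R a) =
       coprod_snd (tensor3_null (via_left t\<^sub>L) (via_left s\<^sub>L) (via_right s\<^sub>R) (via_right t\<^sub>R)) \<gamma>\<^sub>R (\<gamma>\<^sub>L a)"
      "coprod_fst (tensor3_null (via_right s\<^sub>R) (via_right t\<^sub>R) (via_left t\<^sub>L) (via_left s\<^sub>L)) \<gamma>\<^sub>R (\<gamma>\<^sub>L a) =
       coprod_snd (tensor3_null (via_right s\<^sub>R) (via_right t\<^sub>R) (via_left t\<^sub>L) (via_left s\<^sub>L)) \<gamma>\<^sub>L (\<gamma>\<^sub>R a)"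
    and antipode_linear: "linear_map scA scA S"
    and antipode_left_base: "S (t\<^sub>L l' * a * t\<^sub>L l) = s\<^sub>L l * S a * s\<^sub>L l'"
    and antipode_right_base: "S (t\<^sub>R r' * a * t\<^sub>R r) = s\<^sub>R r * S a * s\<^sub>R r'"
    and antipode_left: "tensor_eval (\<lambda>x y. S x * y) (\<gamma>\<^sub>L a) = s\<^sub>R (\<pi>\<^sub>R a)"
    and antipode_right: "tensor_eval (\<lambda>x y. x * S y) (\<gamma>\<^sub>R a) = s\<^sub>L (\<pi>\<^sub>L a)"

text \<open>\<open>A\<^sup>* = Hom\<^sub>R(A\<^sup>R, R)\<close>\<close>

definition right_dual ::
    "('r::{ring,monoid_mult} \<Rightarrow> 'a::{ring,monoid_mult}) \<Rightarrow> ('a \<Rightarrow> 'r) set" where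
  "right_dual s =
     {\<phi>. (\<forall>a b. \<phi> (a + b) = \<phi> a + \<phi> b) \<and> (\<forall>a r. \<phi> (a * s r) = \<phi> a * r)}"

definition left_s_integrals ::
    "('r::{ring,monoid_mult} \<Rightarrow> 'a::{ring,monoid_mult}) \<Rightarrow> ('r \<Rightarrow> 'a)
      \<Rightarrow> ('a \<Rightarrow> ('a \<times> 'a \<Rightarrow>\<^sub>0 int) set) \<Rightarrow> ('a \<Rightarrow> 'r) set" where
  "left_s_integrals s t \<gamma> =
     {\<phi> \<in> right_dual s. \<forall>a. tensor_eval (\<lambda>x y. y * t (\<phi> x)) (\<gamma> a) = s (\<phi> a)}"

text \<open>The action \<open>\<phi> \<cdot> r = \<phi>(- t(r))\<close> on \<open>A\<^sup>*\<close>\<close>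

definition dual_act :: "('r \<Rightarrow> 'a::times) \<Rightarrow> 'r \<Rightarrow> ('a \<Rightarrow> 'r) \<Rightarrow> ('a \<Rightarrow> 'r)" where
  "dual_act t r \<phi> = (\<lambda>b. \<phi> (b * t r))"

text \<open>
  \<open>\<^sup>RA \<otimes> \<L>(\<A>\<^sup>*)\<^sup>R\<close>, balanced by \<open>x * t r \<otimes> \<phi> = x \<otimes> \<phi>(- t(r))\<close>, and its left \<open>A\<close>-module structure.
  Addition in \<open>\<L>(\<A>\<^sup>*)\<close> is pointwise addition of functions.
\<close>

definition integral_tensor ::
    "('r::{ring,monoid_mult} \<Rightarrow> 'a::{ring,monoid_mult}) \<Rightarrow> ('r \<Rightarrow> 'a)
      \<Rightarrow> ('a \<Rightarrow> ('a \<times> 'a \<Rightarrow>\<^sub>0 int) set) \<Rightarrow> ('a \<times> ('a \<Rightarrow> 'r) \<Rightarrow>\<^sub>0 int) set set" where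
  "integral_tensor s t \<gamma> = tensor UNIV (left_s_integrals s t \<gamma>) (via_right t) (dual_act t)"

definition integral_tensor_act ::
    "('r::{ring,monoid_mult} \<Rightarrow> 'a::{ring,monoid_mult}) \<Rightarrow> ('r \<Rightarrow> 'a)
      \<Rightarrow> ('a \<Rightarrow> ('a \<times> 'a \<Rightarrow>\<^sub>0 int) set)
      \<Rightarrow> 'a \<Rightarrow> ('a \<times> ('a \<Rightarrow> 'r) \<Rightarrow>\<^sub>0 int) set \<Rightarrow> ('a \<times> ('a \<Rightarrow> 'r) \<Rightarrow>\<^sub>0 int) set" where
  "integral_tensor_act s t \<gamma> a =
     tensor_map (tensor_null UNIV (left_s_integrals s t \<gamma>) (via_right t) (dual_act t))
       (\<lambda>x. a * x) (\<lambda>\<phi>. \<phi>)"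

text \<open>Invariants of a left \<open>A\<close>-module with carrier \<open>M\<close> and action \<open>act\<close>\<close>

definition invariants ::
    "('l \<Rightarrow> 'a) \<Rightarrow> ('a \<Rightarrow> 'l) \<Rightarrow> 'm set \<Rightarrow> ('a \<Rightarrow> 'm \<Rightarrow> 'm) \<Rightarrow> 'm set" where
  "invariants s \<pi> M act = {n \<in> M. \<forall>a. act a n = act (s (\<pi> a)) n}"

end

(*
A Hopf algebroid is treated over the single base R: with s = s_R, t = t_R there are a ring
automorphism omega of R and a map eps : A -> R such that s_L pi_L = t omega eps and
t_L pi_L = s eps.  Below a_(1) (x) a_(2) is the coproduct of A_L and a^(1) (x) a^(2) that of A_R.

From an invariant sum_k x_k (x) lambda_k with sum_k lambda_k(x_k) = 1, the inverse of S is
h |-> sum_k x_k^(2) t(lambda_k(h x_k^(1))): composing it with S on the right uses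
S(a) x^(1) (x) x^(2) = x^(1) (x) a x^(2), composing on the left uses that the defining property of
the integrals lambda_k also holds with the coproduct of A_L, lambda_k being left R-linear.

If S is bijective, choose dual bases (b_i, beta_i) of A^R and (c_j, eta_j) of ^RA and put
psi_i(h) = eps(h^(2) t(beta_i(h^(1)))).  For eta in Hom_R(^RA, R) the trace formula
E_eta(h) = sum_i psi_i(h Y_eta(b_i)), where Y_eta(b) = t(eta(d^(2))) S^{-1}(d^(1)) and
d = S^{-1}(b), defines an integral, and sum_j c_j (x) E_{eta_j} is the required invariant.  This is
the preimage of eps under the map x (x) lambda |-> lambda(- x), computed by faithfully flat descent.
*)

theory Submission
  imports Defs
begin

section \<open>Evaluation of formal sums and cosets\<close>

text \<open>The obstacle: elements of tensor products are cosets, maps out of them are computed at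
  an arbitrary representative, and over a noncommutative base a product like
  \<open>x u (x) y v\<close> makes sense only after summing over a whole coproduct. Coproducts are
  therefore not manipulated as elements. They are paired with balanced maps into abelian groups, and
  each axiom becomes an identity between such pairings; only the invariance of the constructed
  element is finally proved as an equality of cosets. The axioms do not say how S acts on products
  and coproducts, so \<open>S (a b) = S b S a\<close> and the two rules for the coproducts of
  \<open>S a\<close> are derived first. The trace formula generalizes the one for ordinary Hopf
  algebras. There R = k, \<omega> = id, psi_i = beta_i and
  \<open>Y_eta(b) = eta(S^{-1}(b_(1))) S^{-2}(b_(2))\<close>, so that E_eta(h) is the trace of b |->
  h Y_eta(b). In general Y_eta is only semilinear over the inverse of \<omega>, while an integral
  must also be left R-linear; this is why the coordinate beta_i is replaced by the left linear
  functional psi_i that induces the same comodule endomorphism of A.\<close>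

lemma int_times_eq_diff:
  assumes "n = int a - int b"
  shows "int_times n g = (\<Sum>_<a. g) - (\<Sum>_<b. g)"
proof -
  have split: "(\<Sum>_<p + q. g) = (\<Sum>_<p. g) + (\<Sum>_<q. g)" for p q :: nat
    by (induction q) (simp_all add: algebra_simps)
  show ?thesis
  proof (cases "b \<le> a")
    case True
    then obtain c where "a = c + b"
      using le_Suc_ex by (metis add.commute)
    then show ?thesis
      using assms split[of c b] by (simp add: int_times_def)
  next
    case False
    then obtain c where "b = c + a"
      using le_Suc_ex by (metis add.commute nat_le_linear)
    then show ?thesis
      using assms split[of c a] by (simp add: int_times_def)
  qed
qed

lemma int_times_zero [simp]: "int_times 0 g = 0"
  by (simp add: int_times_def)

lemma int_times_one [simp]: "int_times 1 g = g"
  by (simp add: int_times_def)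

lemma int_times_add: "int_times (m + n) g = int_times m g + int_times n g"
proof -
  obtain a b c d where *: "m = int a - int b" "n = int c - int d"
    by (metis int_diff_cases)
  have "(\<Sum>_<p + q. g) = (\<Sum>_<p. g) + (\<Sum>_<q. g)" for p q :: nat
    by (induction q) (simp_all add: algebra_simps)
  with * show ?thesis
    using int_times_eq_diff[of "m + n" "a + c" "b + d" g]
    by (simp add: int_times_eq_diff[OF refl, of a b] int_times_eq_diff[OF refl, of c d])
qed

text \<open>The universal property of the free abelian group, for an arbitrary abelian group as
  target; \<open>tensor_eval\<close> is this map at the chosen representative.\<close>

definition frag_eval :: "('p \<Rightarrow> 'g::ab_group_add) \<Rightarrow> ('p \<Rightarrow>\<^sub>0 int) \<Rightarrow> 'g" where
  "frag_eval \<phi> x = (\<Sum>p\<in>Poly_Mapping.keys x. int_times (Poly_Mapping.lookup x p) (\<phi> p))"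

lemma frag_eval_superset:
  assumes "finite I" and "Poly_Mapping.keys x \<subseteq> I"
  shows "frag_eval \<phi> x = (\<Sum>p\<in>I. int_times (Poly_Mapping.lookup x p) (\<phi> p))"
  unfolding frag_eval_def
  using assms by (intro sum.mono_neutral_left) (auto simp: in_keys_iff)

lemma frag_eval_zero [simp]: "frag_eval \<phi> 0 = 0"
  by (simp add: frag_eval_def)

lemma frag_eval_of [simp]: "frag_eval \<phi> (frag_of p) = \<phi> p"
  by (simp add: frag_eval_def)

lemma frag_eval_add: "frag_eval \<phi> (x + y) = frag_eval \<phi> x + frag_eval \<phi> y"
proof -
  let ?I = "Poly_Mapping.keys x \<union> Poly_Mapping.keys y"
  have "Poly_Mapping.keys (x + y) \<subseteq> ?I"
    by (rule Poly_Mapping.keys_add)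
  then show ?thesis
    by (simp add: frag_eval_superset[of ?I] lookup_add int_times_add sum.distrib)
qed

lemma frag_eval_uminus: "frag_eval \<phi> (- x) = - frag_eval \<phi> x"
  using frag_eval_add[of \<phi> x "- x"] by (simp add: eq_neg_iff_add_eq_0 add.commute)

lemma frag_eval_diff: "frag_eval \<phi> (x - y) = frag_eval \<phi> x - frag_eval \<phi> y"
  using frag_eval_add[of \<phi> x "- y"] by (simp add: frag_eval_uminus)

lemma frag_eval_sum: "frag_eval \<phi> (\<Sum>i\<in>I. x i) = (\<Sum>i\<in>I. frag_eval \<phi> (x i))"
  by (induction I rule: infinite_finite_induct) (simp_all add: frag_eval_add)

lemma frag_eval_cong:
  "(\<And>p. p \<in> Poly_Mapping.keys x \<Longrightarrow> \<phi> p = \<psi> p) \<Longrightarrow> frag_eval \<phi> x = frag_eval \<psi> x"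
  by (simp add: frag_eval_def cong: sum.cong)

lemma frag_eval_extend: "frag_eval \<phi> (frag_extend \<psi> x) = frag_eval (\<lambda>p. frag_eval \<phi> (\<psi> p)) x"
  using order.refl
  by (induction x rule: frag_induction)
    (simp_all add: frag_extend_diff frag_eval_diff)

lemma frag_eval_additive:
  fixes h :: "'g::ab_group_add \<Rightarrow> 'h::ab_group_add"
  assumes "\<And>a b. h (a + b) = h a + h b"
  shows "h (frag_eval \<phi> x) = frag_eval (\<lambda>p. h (\<phi> p)) x"
proof -
  have 0: "h 0 = 0"
    using assms[of 0 0] by simp
  have "h (- a) = - h a" for a
    using assms[of a "- a"] 0 by (simp add: eq_neg_iff_add_eq_0 add.commute)
  then have diff: "h (a - b) = h a - h b" for a b
    using assms[of a "- b"] by simp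
  show ?thesis
    using order.refl
    by (induction x rule: frag_induction) (simp_all add: frag_eval_diff diff 0)
qed

lemma frag_eval_fun_diff:
  "frag_eval (\<lambda>p. \<phi> p - \<psi> p) x = frag_eval \<phi> x - frag_eval \<psi> x"
  using order.refl
  by (induction x rule: frag_induction) (simp_all add: frag_eval_diff)

lemma frag_eval_fun_zero [simp]: "frag_eval (\<lambda>p. 0) x = 0"
  using order.refl
  by (induction x rule: frag_induction) (simp_all add: frag_eval_diff)

lemma frag_eval_fun_add:
  "frag_eval (\<lambda>p. \<phi> p + \<psi> p) x = frag_eval \<phi> x + frag_eval \<psi> x"
  using frag_eval_fun_diff[of \<phi> "\<lambda>p. - \<psi> p" x] frag_eval_fun_diff[of "\<lambda>p. 0" \<psi> x] by simp

lemma frag_eval_fun_sum: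
  "frag_eval (\<lambda>p. \<Sum>i\<in>I. \<phi> i p) x = (\<Sum>i\<in>I. frag_eval (\<phi> i) x)"
  by (induction I rule: infinite_finite_induct) (simp_all add: frag_eval_fun_add)

lemma frag_eval_swap:
  "frag_eval (\<lambda>p. frag_eval (\<lambda>q. \<phi> p q) y) x = frag_eval (\<lambda>q. frag_eval (\<lambda>p. \<phi> p q) x) y"
  using order.refl
  by (induction x rule: frag_induction) (simp_all add: frag_eval_diff frag_eval_fun_diff)

lemma frag_eval_closure:
  assumes "x \<in> group_closure T" and "\<And>r. r \<in> T \<Longrightarrow> frag_eval \<phi> r = 0"
  shows "frag_eval \<phi> x = 0"
  using assms by (induction rule: group_closure.induct) (auto simp: frag_eval_diff)

lemma tensor_eval_eq: "tensor_eval \<phi> X = frag_eval (\<lambda>p. \<phi> (fst p) (snd p)) (rep X)"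
  unfolding tensor_eval_def frag_eval_def by (rule sum.cong) auto

lemma rep_coset:
  assumes "0 \<in> K"
  shows "rep (coset K x) - x \<in> K"
proof -
  have "x \<in> coset K x"
    using assms by (simp add: coset_def)
  then have "rep (coset K x) \<in> coset K x"
    unfolding rep_def by (rule someI)
  then show ?thesis
    by (simp add: coset_def)
qed

text \<open>Two representatives differ by an element of the subgroup, so a homomorphism that kills
  the subgroup does not see which one was chosen.\<close>

lemma frag_eval_rep_coset:
  assumes "\<And>z. z \<in> group_closure T \<Longrightarrow> frag_eval \<phi> z = 0"
  shows "frag_eval \<phi> (rep (coset (group_closure T) x)) = frag_eval \<phi> x"
  using assms[OF rep_coset[of "group_closure T" x]] by (simp add: frag_eval_diff)

lemma coset_eqI:
  assumes "x - y \<in> group_closure T"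
  shows "coset (group_closure T) x = coset (group_closure T) y"
proof -
  have "z - x \<in> group_closure T \<longleftrightarrow> z - y \<in> group_closure T" for z
    using group_closure_add[OF _ assms, of "z - x"] group_closure.diff[OF _ assms, of "z - y"]
    by (auto simp: algebra_simps)
  then show ?thesis
    by (simp add: coset_def)
qed

section \<open>Maps out of tensor products\<close>

definition biadditive :: "('m::plus \<Rightarrow> 'n::plus \<Rightarrow> 'g::plus) \<Rightarrow> bool" where
  "biadditive f \<longleftrightarrow>
     (\<forall>x x' y. f (x + x') y = f x y + f x' y) \<and> (\<forall>x y y'. f x (y + y') = f x y + f x y')"

definition balanced :: "('b \<Rightarrow> 'm \<Rightarrow> 'm) \<Rightarrow> ('b \<Rightarrow> 'n \<Rightarrow> 'n)
    \<Rightarrow> ('m::plus \<Rightarrow> 'n::plus \<Rightarrow> 'g::plus) \<Rightarrow> bool" where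
  "balanced act act' f \<longleftrightarrow> biadditive f \<and> (\<forall>b x y. f (act b x) y = f x (act' b y))"

lemma frag_eval_tensor_null:
  assumes "\<And>m m' n. m \<in> M \<Longrightarrow> m' \<in> M \<Longrightarrow> n \<in> N \<Longrightarrow> f (m + m') n = f m n + f m' n"
    and "\<And>m n n'. m \<in> M \<Longrightarrow> n \<in> N \<Longrightarrow> n' \<in> N \<Longrightarrow> f m (n + n') = f m n + f m n'"
    and "\<And>b m n. m \<in> M \<Longrightarrow> n \<in> N \<Longrightarrow> f (act b m) n = f m (act' b n)"
    and "x \<in> tensor_null M N act act'"
  shows "frag_eval (\<lambda>p. f (fst p) (snd p)) x = 0"
  using assms(4) unfolding tensor_null_def
  by (rule frag_eval_closure) (auto simp: frag_eval_diff assms(1-3))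

lemma frag_eval_tensor3_null:
  assumes "\<And>x x' y z. f (x + x') y z = f x y z + f x' y z"
    and "\<And>x y y' z. f x (y + y') z = f x y z + f x y' z"
    and "\<And>x y z z'. f x y (z + z') = f x y z + f x y z'"
    and "\<And>b x y z. f (act1 b x) y z = f x (act2 b y) z"
    and "\<And>c x y z. f x (act3 c y) z = f x y (act4 c z)"
    and "x \<in> tensor3_null act1 act2 act3 act4"
  shows "frag_eval (\<lambda>p. f (fst p) (fst (snd p)) (snd (snd p))) x = 0"
  using assms(6) unfolding tensor3_null_def
  by (rule frag_eval_closure) (auto simp: frag_eval_diff assms(1-5))

lemma frag_eval_rep_tensor:
  assumes "balanced act act' f"
  shows "frag_eval (\<lambda>p. f (fst p) (snd p)) (rep (coset (tensor_null UNIV UNIV act act') x)) =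
    frag_eval (\<lambda>p. f (fst p) (snd p)) x"
  unfolding tensor_null_def
  by (rule frag_eval_rep_coset, rule frag_eval_tensor_null[where M = UNIV and N = UNIV])
    (use assms in \<open>auto simp: balanced_def biadditive_def tensor_null_def\<close>)

text \<open>The inner representative \<open>rep X\<close> occurs unchanged on both sides. Hence only
  \<open>f\<close>, which is applied to the outer coset, has to be balanced; the same holds for the
  three lemmas that follow.\<close>

lemma tensor_eval_induced:
  assumes "balanced act act' f"
  shows "tensor_eval f (induced (tensor_null UNIV UNIV act act') \<phi> X) =
    frag_eval (\<lambda>p. frag_eval (\<lambda>p. f (fst p) (snd p)) (\<phi> p)) (rep X)"
  by (simp add: tensor_eval_eq induced_def frag_eval_rep_tensor[OF assms] frag_eval_extend)

lemma tensor_eval_tensor_map: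
  assumes "balanced act act' f"
  shows "tensor_eval f (tensor_map (tensor_null UNIV UNIV act act') g h X) =
    tensor_eval (\<lambda>x y. f (g x) (h y)) X"
  by (simp add: tensor_map_def tensor_eval_induced[OF assms] case_prod_unfold, simp add: tensor_eval_eq)

lemma tensor_eval_tensor_mult:
  assumes "balanced act act' f"
  shows "tensor_eval f (tensor_mult (tensor_null UNIV UNIV act act') X Y) =
    tensor_eval (\<lambda>x y. tensor_eval (\<lambda>u v. f (x * u) (y * v)) Y) X"
  by (simp add: tensor_mult_def tensor_eval_induced[OF assms] case_prod_unfold frag_eval_extend,
      simp add: tensor_eval_eq)

lemma tensor_eval_tensor_add:
  assumes "balanced act act' f"
  shows "tensor_eval f (tensor_add (tensor_null UNIV UNIV act act') X Y) =
    tensor_eval f X + tensor_eval f Y"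
  by (simp add: tensor_add_def frag_eval_rep_tensor[OF assms] tensor_eval_eq frag_eval_add)

lemma tensor_eval_coset_of:
  assumes "balanced act act' f"
  shows "tensor_eval f (coset (tensor_null UNIV UNIV act act') (frag_of (x, y))) = f x y"
  by (simp add: frag_eval_rep_tensor[OF assms] tensor_eval_eq)

definition triadditive :: "('m::plus \<Rightarrow> 'n::plus \<Rightarrow> 'p::plus \<Rightarrow> 'g::plus) \<Rightarrow> bool" where
  "triadditive f \<longleftrightarrow>
     (\<forall>x x' y z. f (x + x') y z = f x y z + f x' y z) \<and>
     (\<forall>x y y' z. f x (y + y') z = f x y z + f x y' z) \<and>
     (\<forall>x y z z'. f x y (z + z') = f x y z + f x y z')"

definition balanced3 :: "('b \<Rightarrow> 'a \<Rightarrow> 'a) \<Rightarrow> ('b \<Rightarrow> 'a \<Rightarrow> 'a) \<Rightarrow> ('c \<Rightarrow> 'a \<Rightarrow> 'a) \<Rightarrow> ('c \<Rightarrow> 'a \<Rightarrow> 'a)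
    \<Rightarrow> ('a::plus \<Rightarrow> 'a \<Rightarrow> 'a \<Rightarrow> 'g::plus) \<Rightarrow> bool" where
  "balanced3 act1 act2 act3 act4 f \<longleftrightarrow> triadditive f \<and>
     (\<forall>b x y z. f (act1 b x) y z = f x (act2 b y) z) \<and>
     (\<forall>c x y z. f x (act3 c y) z = f x y (act4 c z))"

text \<open>Evaluation by \<open>f\<close> is well defined on the threefold tensor product, so it
  may be applied to both sides of the equality of cosets. Allowing two coproducts and two pairs of
  actions covers the coassociativity of each coproduct and both mixed laws at once.\<close>

lemma coassoc_eval:
  assumes "coprod_fst (tensor3_null act1 act2 act3 act4) \<gamma> X =
      coprod_snd (tensor3_null act1 act2 act3 act4) \<gamma>' Y"
    and "balanced3 act1 act2 act3 act4 f"
  shows "tensor_eval (\<lambda>b z. tensor_eval (\<lambda>x y. f x y z) (\<gamma> b)) X =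
    tensor_eval (\<lambda>x c. tensor_eval (\<lambda>y z. f x y z) (\<gamma>' c)) Y"
proof -
  let ?K = "tensor3_null act1 act2 act3 act4"
  let ?e = "frag_eval (\<lambda>p. f (fst p) (fst (snd p)) (snd (snd p)))"
  have K: "?e (rep (coset ?K x)) = ?e x" for x
    unfolding tensor3_null_def
    by (rule frag_eval_rep_coset, rule frag_eval_tensor3_null[of f act1 act2 act3 act4])
      (use assms(2) in \<open>auto simp: balanced3_def triadditive_def tensor3_null_def\<close>)
  have "?e (rep (coprod_fst ?K \<gamma> X)) = ?e (rep (coprod_snd ?K \<gamma>' Y))"
    by (simp only: assms(1))
  then show ?thesis
    by (simp add: coprod_fst_def coprod_snd_def induced_def K frag_eval_extend
        case_prod_unfold tensor_eval_eq)
qed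

lemma tensor_eval_fun_add:
  "tensor_eval (\<lambda>x y. f x y + g x y) X = tensor_eval f X + tensor_eval g X"
  by (simp add: tensor_eval_eq case_prod_unfold frag_eval_fun_add)

lemma tensor_eval_additive:
  fixes h :: "'g::ab_group_add \<Rightarrow> 'h::ab_group_add"
  assumes "\<And>a b. h (a + b) = h a + h b"
  shows "h (tensor_eval f X) = tensor_eval (\<lambda>x y. h (f x y)) X"
  by (simp add: tensor_eval_eq case_prod_unfold frag_eval_additive[of h, OF assms])

lemma tensor_eval_fun_sum:
  "tensor_eval (\<lambda>x y. \<Sum>i\<in>I. f i x y) X = (\<Sum>i\<in>I. tensor_eval (f i) X)"
  by (simp add: tensor_eval_eq case_prod_unfold frag_eval_fun_sum)

lemma tensor_eval_swap:
  "tensor_eval (\<lambda>x y. tensor_eval (\<lambda>u v. f x y u v) Y) X =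
   tensor_eval (\<lambda>u v. tensor_eval (\<lambda>x y. f x y u v) X) Y"
  unfolding tensor_eval_eq case_prod_unfold by (rule frag_eval_swap)

section \<open>Computing with relators and cosets themselves\<close>

lemma tensor_null_zero: "0 \<in> tensor_null M N act act'"
  and tensor_null_add: "x \<in> tensor_null M N act act' \<Longrightarrow> y \<in> tensor_null M N act act' \<Longrightarrow>
    x + y \<in> tensor_null M N act act'"
  and tensor_null_minus: "- x \<in> tensor_null M N act act' \<longleftrightarrow> x \<in> tensor_null M N act act'"
  unfolding tensor_null_def by (simp_all add: group_closure_add)

lemma tensor_null_sum:
  "(\<And>j. j \<in> J \<Longrightarrow> x j \<in> tensor_null M N act act') \<Longrightarrow> (\<Sum>j\<in>J. x j) \<in> tensor_null M N act act'"
  by (induction J rule: infinite_finite_induct) (simp_all add: tensor_null_zero tensor_null_add)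

lemma coset_tensor_eqI:
  "x - y \<in> tensor_null M N act act' \<Longrightarrow>
    coset (tensor_null M N act act') x = coset (tensor_null M N act act') y"
  unfolding tensor_null_def by (rule coset_eqI)

lemma tensor_null_balance:
  "m \<in> M \<Longrightarrow> n \<in> N \<Longrightarrow> frag_of (act b m, n) - frag_of (m, act' b n) \<in> tensor_null M N act act'"
  unfolding tensor_null_def by (intro group_closure.base insertI2) auto

text \<open>An additive \<open>u\<close> that commutes with the action sends each relator to a
  relator or to zero. This computes the module action on a coset itself, as needed for proving
  invariance, which is an equality in the tensor product.\<close>

lemma tensor_map_coset_left:
  fixes u :: "'m::plus \<Rightarrow> 'm" and N :: "'n::plus set"
  assumes "\<And>m m'. u (m + m') = u m + u m'" and "\<And>b m. u (act b m) = act b (u m)"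
  shows "tensor_map (tensor_null UNIV N act act') u (\<lambda>n. n) (coset (tensor_null UNIV N act act') x) =
    coset (tensor_null UNIV N act act') (frag_extend (\<lambda>(m, n). frag_of (u m, n)) x)"
proof -
  let ?K = "tensor_null UNIV N act act'" and ?g = "\<lambda>(m, n::'n). frag_of (u m, n)"
  have "frag_extend ?g z \<in> ?K" if "z \<in> ?K" for z
  proof -
    have add1: "frag_of (m + m', n) - frag_of (m, n) - frag_of (m', n) \<in> ?K" if "n \<in> N"
      for m m' :: 'm and n :: 'n
      unfolding tensor_null_def using that by (intro group_closure.base insertI2) auto
    have add2: "frag_of (m, n + n') - frag_of (m, n) - frag_of (m, n') \<in> ?K"
      if "n \<in> N" "n' \<in> N" for m :: 'm and n n' :: 'n
      unfolding tensor_null_def using that by (intro group_closure.base insertI2) auto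
    show ?thesis
      using that[unfolded tensor_null_def]
    proof (induction rule: group_closure.induct)
      case (base r)
      then show ?case
        by (auto simp: frag_extend_diff assms tensor_null_zero add1 add2 tensor_null_balance)
    next
      case (diff r r')
      then show ?case
        using tensor_null_add[of "frag_extend ?g r" UNIV N act act' "- frag_extend ?g r'"]
        by (simp add: frag_extend_diff tensor_null_minus)
    qed
  qed
  then have "frag_extend ?g (rep (coset ?K x) - x) \<in> ?K"
    by (simp add: rep_coset tensor_null_zero)
  then show ?thesis
    by (simp add: tensor_map_def induced_def coset_tensor_eqI frag_extend_diff)
qed

lemma tensor_null_sum_left:
  fixes x :: "'j \<Rightarrow> 'm::comm_monoid_add" and N :: "'n::plus set"
  assumes n: "n \<in> N"
  shows "frag_of (\<Sum>j\<in>J. x j, n) - (\<Sum>j\<in>J. frag_of (x j, n)) \<in> tensor_null UNIV N act act'"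
proof -
  let ?K = "tensor_null UNIV N act act'"
  have add: "frag_of (m + m', n) - frag_of (m, n) - frag_of (m', n) \<in> ?K" for m m'
    unfolding tensor_null_def using n by (intro group_closure.base insertI2) auto
  \<comment> \<open>The additivity relator with both summands 0 is minus this generator.\<close>
  have zero: "frag_of (0, n) \<in> ?K"
    using add[of 0 0] by (simp add: tensor_null_minus)
  show ?thesis
  proof (induction J rule: infinite_finite_induct)
    case (insert j J)
    from tensor_null_add[OF insert.IH add[of "x j" "\<Sum>j\<in>J. x j"]] show ?case
      using insert.hyps by (simp add: algebra_simps)
  qed (simp_all add: zero)
qed

lemma tensor_null_sum_right:
  fixes x :: "'j \<Rightarrow> 'n::comm_monoid_add"
  assumes "m \<in> M" and "0 \<in> N" and "\<And>n n'. n \<in> N \<Longrightarrow> n' \<in> N \<Longrightarrow> n + n' \<in> N"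
    and "\<And>j. j \<in> J \<Longrightarrow> x j \<in> N"
  shows "frag_of (m, \<Sum>j\<in>J. x j) - (\<Sum>j\<in>J. frag_of (m, x j)) \<in> tensor_null M N act act'"
proof -
  let ?K = "tensor_null M N act act'"
  have add: "frag_of (m, n + n') - frag_of (m, n) - frag_of (m, n') \<in> ?K"
    if "n \<in> N" "n' \<in> N" for n n'
    unfolding tensor_null_def using that assms(1) by (intro group_closure.base insertI2) auto
  have zero: "frag_of (m, 0) \<in> ?K"
    using add[of 0 0] assms(2) by (simp add: tensor_null_minus)
  show ?thesis
    using assms(4)
  proof (induction J rule: infinite_finite_induct)
    case (insert j J)
    have "(\<Sum>j\<in>J. x j) \<in> N"
      using assms(2,3) insert.prems by (induction J rule: infinite_finite_induct) auto
    with insert.prems have "frag_of (m, x j + (\<Sum>j\<in>J. x j)) - frag_of (m, x j) - frag_of (m, \<Sum>j\<in>J. x j) \<in> ?K"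
      by (intro add) auto
    from tensor_null_add[OF insert.IH this] show ?case
      using insert.hyps insert.prems by (simp add: algebra_simps)
  qed (simp_all add: zero)
qed

text \<open>The free module that contains the given one as a summand may have infinite rank, but
  finitely many generators have finitely many coordinates in total. The \<xi> are the remaining
  coordinate functions of the embedding, the \<open>v\<close> the projections of the free basis. The
  parameter \<open>reg\<close> serves left and right modules together; \<open>reg b 0 = 0\<close> is
  needed because \<open>Poly_Mapping.map\<close> keeps zero coefficients at zero.\<close>

lemma dual_basis:
  fixes act :: "'b::{ring,monoid_mult} \<Rightarrow> 'm::ab_group_add \<Rightarrow> 'm"
  assumes fg: "finitely_generated act" and "projective reg act"
    and reg: "\<And>b. reg b 0 = 0" "\<And>b. reg b 1 = b"
  shows "\<exists>(K :: 'm set) v \<xi>. finite K \<and> (\<forall>m. (\<Sum>x\<in>K. act (\<xi> x m) (v x)) = m) \<and>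
    (\<forall>x m m'. \<xi> x (m + m') = \<xi> x m + \<xi> x m') \<and> (\<forall>x b m. \<xi> x (act b m) = reg b (\<xi> x m))"
proof -
  obtain I and i :: "'m \<Rightarrow> 'm \<Rightarrow>\<^sub>0 'b" and p where
    keys_i: "\<And>m. Poly_Mapping.keys (i m) \<subseteq> I"
    and i_add: "\<And>m m'. i (m + m') = i m + i m'"
    and i_act: "\<And>b m. i (act b m) = Poly_Mapping.map (reg b) (i m)"
    and p_add: "\<And>f g. Poly_Mapping.keys f \<subseteq> I \<Longrightarrow> Poly_Mapping.keys g \<subseteq> I \<Longrightarrow> p (f + g) = p f + p g"
    and p_act: "\<And>b f. Poly_Mapping.keys f \<subseteq> I \<Longrightarrow> p (Poly_Mapping.map (reg b) f) = act b (p f)"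
    and p_i: "\<And>m. p (i m) = m"
    using assms(2) unfolding projective_def by blast
  have lookup_map: "Poly_Mapping.lookup (Poly_Mapping.map (reg b) f) x = reg b (Poly_Mapping.lookup f x)"
    for b x and f :: "'m \<Rightarrow>\<^sub>0 'b"
    by (simp add: Poly_Mapping.map.rep_eq when_def reg)
  obtain X c where X: "finite X" and c: "\<And>m. m = (\<Sum>x\<in>X. act (c m x) x)"
    using fg unfolding finitely_generated_def by metis
  \<comment> \<open>All coordinates that occur in the generators; by linearity no element has
    coordinates outside \<open>K\<close>.\<close>
  define K where "K = (\<Union>x\<in>X. Poly_Mapping.keys (i x))"
  have K: "finite K" "K \<subseteq> I"
    using X keys_i by (auto simp: K_def)
  have i0: "i 0 = 0"
    using i_add[of 0 0] by simp
  have i_sum: "i (\<Sum>x\<in>Y. g x) = (\<Sum>x\<in>Y. i (g x))" for Y :: "'m set" and g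
    by (induction Y rule: infinite_finite_induct) (simp_all add: i_add i0)
  have "Poly_Mapping.lookup (i m) y = 0" if "y \<notin> K" for m y
  proof -
    have "Poly_Mapping.lookup (i x) y = 0" if "x \<in> X" for x
      using \<open>y \<notin> K\<close> that by (auto simp: K_def in_keys_iff)
    then have "Poly_Mapping.lookup (\<Sum>x\<in>X. i (act (c m x) x)) y = 0"
      by (simp add: lookup_sum i_act lookup_map reg)
    then show ?thesis
      by (metis c i_sum)
  qed
  then have keys_K: "Poly_Mapping.keys (i m) \<subseteq> K" for m
    by (auto simp: in_keys_iff)
  let ?single = "\<lambda>x. Poly_Mapping.single x (1::'b)"
  have p0: "p 0 = 0"
    using p_add[of 0 0] by simp
  have p_sum: "p (\<Sum>x\<in>Y. Poly_Mapping.map (reg (d x)) (?single x)) = (\<Sum>x\<in>Y. act (d x) (p (?single x)))"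
    if "Y \<subseteq> I" for Y d
    using that
  proof (induction Y rule: infinite_finite_induct)
    case (insert x Y)
    have "Poly_Mapping.keys (Poly_Mapping.map (reg (d x)) (?single x)) \<subseteq> I"
      if "x \<in> I" for x
      using that by (auto simp: in_keys_iff lookup_map lookup_single when_def reg split: if_splits)
    moreover from this have "Poly_Mapping.keys (\<Sum>x\<in>Y. Poly_Mapping.map (reg (d x)) (?single x)) \<subseteq> I"
      using insert.prems by (intro order.trans[OF keys_sum]) blast
    moreover have "Poly_Mapping.keys (?single x) \<subseteq> I"
      using insert.prems by simp
    ultimately show ?case
      using insert by (simp add: p_add p_act)
  qed (simp_all add: p0)
  have expand: "i m = (\<Sum>x\<in>K. Poly_Mapping.map (reg (Poly_Mapping.lookup (i m) x)) (?single x))" for m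
  proof (rule poly_mapping_eqI)
    fix y
    have "Poly_Mapping.lookup (i m) y = (if y \<in> K then Poly_Mapping.lookup (i m) y else 0)"
      using keys_K[of m] by (auto simp: in_keys_iff)
    then show "Poly_Mapping.lookup (i m) y =
        Poly_Mapping.lookup (\<Sum>x\<in>K. Poly_Mapping.map (reg (Poly_Mapping.lookup (i m) x)) (?single x)) y"
      using K(1)
      by (simp add: lookup_sum lookup_map lookup_single when_def reg if_distrib
          if_distribR sum.delta cong: if_cong)
  qed
  have "(\<Sum>x\<in>K. act (Poly_Mapping.lookup (i m) x) (p (?single x))) = m" for m
    using p_sum[OF K(2), of "Poly_Mapping.lookup (i m)"] by (simp add: p_i flip: expand)
  with K(1) show ?thesis
    by (intro exI[of _ K] exI[of _ "\<lambda>x. p (?single x)"] exI[of _ "\<lambda>x m. Poly_Mapping.lookup (i m) x"])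
      (simp add: i_add i_act lookup_add lookup_map)
qed

context hopf_algebroid
begin

section \<open>The base ring\<close>

abbreviation s :: "'r \<Rightarrow> 'a" where "s \<equiv> s\<^sub>R"
abbreviation t :: "'r \<Rightarrow> 'a" where "t \<equiv> t\<^sub>R"

text \<open>
  The data over \<open>L\<close> are transported to \<open>R\<close>: every \<open>t\<^sub>L l\<close> is of the form \<open>s r\<close>, and then
  \<open>s\<^sub>L l = t (\<omega> r)\<close>. In particular \<open>s\<^sub>L (\<pi>\<^sub>L a) = t (\<omega> (\<epsilon> a))\<close> and \<open>t\<^sub>L (\<pi>\<^sub>L a) = s (\<epsilon> a)\<close>.
\<close>

definition \<omega> :: "'r \<Rightarrow> 'r" where "\<omega> r = \<pi>\<^sub>R (s\<^sub>L (\<pi>\<^sub>L (s\<^sub>R r)))"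

definition \<epsilon> :: "'a \<Rightarrow> 'r" where "\<epsilon> a = \<pi>\<^sub>R (t\<^sub>L (\<pi>\<^sub>L a))"

abbreviation \<pi> :: "'a \<Rightarrow> 'r" where "\<pi> \<equiv> \<pi>\<^sub>R"

lemma s_add [simp]: "s (r + r') = s r + s r'"
  and s_one [simp]: "s 1 = 1"
  and s_mult [simp]: "s (r * r') = s r * s r'"
  using right.source by (simp_all add: algebra_hom_def linear_map_def)

lemma t_add [simp]: "t (r + r') = t r + t r'"
  and t_one [simp]: "t 1 = 1"
  and t_mult [simp]: "t (r * r') = t r' * t r"
  using right.target by (simp_all add: algebra_antihom_def linear_map_def)

lemma sL_add: "s\<^sub>L (l + l') = s\<^sub>L l + s\<^sub>L l'"
  and sL_one: "s\<^sub>L 1 = 1"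
  and sL_mult: "s\<^sub>L (l * l') = s\<^sub>L l * s\<^sub>L l'"
  using left.source by (simp_all add: algebra_hom_def linear_map_def)

lemma tL_add: "t\<^sub>L (l + l') = t\<^sub>L l + t\<^sub>L l'"
  and tL_one: "t\<^sub>L 1 = 1"
  and tL_mult: "t\<^sub>L (l * l') = t\<^sub>L l' * t\<^sub>L l"
  using left.target by (simp_all add: algebra_antihom_def linear_map_def)

lemma t_s_commute: "t r * s r' = s r' * t r"
  by (simp add: right.commuting_ranges)

lemma t_s_commute_left: "t r * (s r' * a) = s r' * (t r * a)"
  by (simp add: t_s_commute flip: mult.assoc)

lemma pi_add [simp]: "\<pi> (a + b) = \<pi> a + \<pi> b"
  by (rule right.counit_add)

lemma pi_one [simp]: "\<pi> 1 = 1"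
  by (rule right.counit_one)

lemma pi_right_s [simp]: "\<pi> (a * s r) = \<pi> a * r"
  using right.counit_bimodule[of a r 1] by simp

lemma pi_right_t [simp]: "\<pi> (a * t r) = r * \<pi> a"
  using right.counit_bimodule[of a 1 r] by simp

lemma pi_s [simp]: "\<pi> (s r) = r"
  using pi_right_s[of 1 r] by simp

lemma pi_t [simp]: "\<pi> (t r) = r"
  using pi_right_t[of 1 r] by simp

lemma piL_left_s: "\<pi>\<^sub>L (s\<^sub>L l * a) = l * \<pi>\<^sub>L a"
  using left.counit_bimodule[of l 1 a] by (simp add: tL_one)

lemma piL_left_t: "\<pi>\<^sub>L (t\<^sub>L l * a) = \<pi>\<^sub>L a * l"
  using left.counit_bimodule[of 1 l a] by (simp add: sL_one)

lemma piL_s: "\<pi>\<^sub>L (s\<^sub>L l) = l"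
  using piL_left_s[of l 1] by (simp add: left.counit_one)

lemma piL_t: "\<pi>\<^sub>L (t\<^sub>L l) = l"
  using piL_left_t[of l 1] by (simp add: left.counit_one)

lemma sL_piL_s: "s\<^sub>L (\<pi>\<^sub>L (s r)) = t (\<omega> r)"
  by (simp add: \<omega>_def base_compat)

lemma sL_eq: "s\<^sub>L l = t (\<omega> (\<pi> (t\<^sub>L l)))"
  by (simp add: base_compat piL_t flip: sL_piL_s)

lemma tL_eq: "t\<^sub>L l = s (\<pi> (t\<^sub>L l))"
  by (simp add: base_compat)

lemma sL_piL: "s\<^sub>L (\<pi>\<^sub>L a) = t (\<omega> (\<epsilon> a))"
  by (simp add: sL_eq[of "\<pi>\<^sub>L a"] \<epsilon>_def)

lemma tL_piL: "t\<^sub>L (\<pi>\<^sub>L a) = s (\<epsilon> a)"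
  by (simp add: \<epsilon>_def base_compat)

lemma s_inject: "s r = s r' \<longleftrightarrow> r = r'"
  by (metis pi_s)

lemma t_inject: "t r = t r' \<longleftrightarrow> r = r'"
  by (metis pi_t)

lemma omega_add [simp]: "\<omega> (r + r') = \<omega> r + \<omega> r'"
  by (simp add: \<omega>_def left.counit_add sL_add)

text \<open>Two reversals cancel: \<open>\<pi>\<^sub>L\<close> reverses products of elements
  \<open>s r\<close>, since these lie in the range of \<open>t\<^sub>L\<close>, and \<open>t\<close>
  reverses products again.\<close>

lemma omega_mult [simp]: "\<omega> (r * r') = \<omega> r * \<omega> r'"
proof -
  have "\<pi>\<^sub>L (s (r * r')) = \<pi>\<^sub>L (s r') * \<pi>\<^sub>L (s r)"
    using piL_left_t[of "\<pi>\<^sub>L (s r)" "s r'"] by (simp add: base_compat)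
  then have "s\<^sub>L (\<pi>\<^sub>L (s (r * r'))) = s\<^sub>L (\<pi>\<^sub>L (s r')) * s\<^sub>L (\<pi>\<^sub>L (s r))"
    by (simp add: sL_mult)
  then have "t (\<omega> (r * r')) = t (\<omega> r * \<omega> r')"
    by (simp add: sL_piL_s del: s_mult)
  then show ?thesis
    by (simp only: t_inject)
qed

text \<open>The inverse takes the same route through L in the other direction: \<open>t r\<close>
  equals \<open>s\<^sub>L l\<close> for \<open>l = \<pi>\<^sub>L (t r)\<close>, and then
  \<open>t\<^sub>L l\<close> is of the form \<open>s r'\<close> with
  \<open>\<omega> r' = r\<close>.\<close>

lemma bij_omega: "bij \<omega>"
proof (rule o_bij)
  show "(\<lambda>r. \<pi> (t\<^sub>L (\<pi>\<^sub>L (t r)))) \<circ> \<omega> = id"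
    by (rule ext) (simp add: base_compat piL_s flip: sL_piL_s)
  have "t (\<omega> (\<pi> (t\<^sub>L (\<pi>\<^sub>L (t r))))) = t r" for r
    by (simp add: base_compat flip: sL_eq)
  then show "\<omega> \<circ> (\<lambda>r. \<pi> (t\<^sub>L (\<pi>\<^sub>L (t r)))) = id"
    by (auto simp: t_inject)
qed

lemma eps_add [simp]: "\<epsilon> (a + b) = \<epsilon> a + \<epsilon> b"
  by (simp add: \<epsilon>_def left.counit_add tL_add)

lemma eps_one [simp]: "\<epsilon> 1 = 1"
  by (simp add: \<epsilon>_def left.counit_one tL_one)

lemma eps_left_s [simp]: "\<epsilon> (s r * a) = r * \<epsilon> a"
proof -
  have "s (\<epsilon> (s r * a)) = s r * s (\<epsilon> a)"
    using piL_left_t[of "\<pi>\<^sub>L (s r)" a] by (simp add: base_compat tL_mult flip: tL_piL)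
  then show ?thesis
    by (simp flip: s_mult add: s_inject)
qed

lemma eps_s [simp]: "\<epsilon> (s r) = r"
  using eps_left_s[of r 1] by simp

lemma eps_left_t [simp]: "\<epsilon> (t (\<omega> r) * a) = \<epsilon> a * r"
proof -
  have "s (\<epsilon> (t (\<omega> r) * a)) = s (\<epsilon> a) * s r"
    by (simp add: tL_mult piL_left_s base_compat flip: sL_piL_s tL_piL)
  then show ?thesis
    by (simp flip: s_mult add: s_inject)
qed

lemma eps_t [simp]: "\<epsilon> (t (\<omega> r)) = r"
  using eps_left_t[of r 1] by simp

lemma eps_mult_s: "\<epsilon> (a * s (\<epsilon> b)) = \<epsilon> (a * b)"
  by (simp only: left.counit_target \<epsilon>_def[of "a * _"] flip: tL_piL)

lemma eps_mult_t: "\<epsilon> (a * t (\<omega> (\<epsilon> b))) = \<epsilon> (a * b)"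
  by (simp only: left.counit_source \<epsilon>_def[of "a * _"] flip: sL_piL)

lemma eps_right_t: "\<epsilon> (a * t (\<omega> r)) = \<epsilon> (a * s r)"
  using eps_mult_t[of a "s r"] by simp

lemma pi_mult_t: "\<pi> (t (\<pi> a) * b) = \<pi> (a * b)"
  by (rule right.counit_target)

section \<open>Sweedler calculus\<close>

text \<open>
  Sweedler's \<open>f(a\<^sub>(\<^sub>1\<^sub>), a\<^sub>(\<^sub>2\<^sub>))\<close> and \<open>f(a\<^sup>(\<^sup>1\<^sup>), a\<^sup>(\<^sup>2\<^sup>))\<close>, independent of the chosen
  representative only if \<open>f\<close> is balanced.
\<close>

definition sumL :: "'a \<Rightarrow> ('a \<Rightarrow> 'a \<Rightarrow> 'g::ab_group_add) \<Rightarrow> 'g" where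
  "sumL a f = tensor_eval f (\<gamma>\<^sub>L a)"

definition sumR :: "'a \<Rightarrow> ('a \<Rightarrow> 'a \<Rightarrow> 'g::ab_group_add) \<Rightarrow> 'g" where
  "sumR a f = tensor_eval f (\<gamma>\<^sub>R a)"

text \<open>Balancing over L, rewritten over R: the relation
  \<open>t\<^sub>L l x (x) y = x (x) s\<^sub>L l y\<close> with \<open>t\<^sub>L l = s r\<close> and
  \<open>s\<^sub>L l = t (\<omega> r)\<close>.\<close>

definition balL :: "('a \<Rightarrow> 'a \<Rightarrow> 'g::ab_group_add) \<Rightarrow> bool" where
  "balL f \<longleftrightarrow> biadditive f \<and> (\<forall>r x y. f (s r * x) y = f x (t (\<omega> r) * y))"

definition balR :: "('a \<Rightarrow> 'a \<Rightarrow> 'g::ab_group_add) \<Rightarrow> bool" where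
  "balR f \<longleftrightarrow> biadditive f \<and> (\<forall>r x y. f (x * s r) y = f x (y * t r))"

lemma balLI:
  assumes "\<And>x x' y. f (x + x') y = f x y + f x' y"
    and "\<And>x y y'. f x (y + y') = f x y + f x y'"
    and "\<And>r x y. f (s r * x) y = f x (t (\<omega> r) * y)"
  shows "balL f"
  using assms by (simp add: balL_def biadditive_def)

lemma balRI:
  assumes "\<And>x x' y. f (x + x') y = f x y + f x' y"
    and "\<And>x y y'. f x (y + y') = f x y + f x y'"
    and "\<And>r x y. f (x * s r) y = f x (y * t r)"
  shows "balR f"
  using assms by (simp add: balR_def biadditive_def)

lemma balL_bal: "balL f \<Longrightarrow> f (s r * x) y = f x (t (\<omega> r) * y)"
  by (simp add: balL_def biadditive_def)

lemma balR_add1: "balR f \<Longrightarrow> f (x + x') y = f x y + f x' y"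
  and balR_add2: "balR f \<Longrightarrow> f x (y + y') = f x y + f x y'"
  and balR_bal: "balR f \<Longrightarrow> f (x * s r) y = f x (y * t r)"
  by (simp_all add: balR_def biadditive_def)

lemma balL_balanced:
  assumes "balL f"
  shows "balanced (via_left t\<^sub>L) (via_left s\<^sub>L) f"
proof -
  have "f (t\<^sub>L l * x) y = f x (s\<^sub>L l * y)" for l x y
    using assms unfolding balL_def by (metis sL_eq tL_eq)
  then show ?thesis
    using assms by (simp add: balanced_def balL_def via_left_def)
qed

lemma balR_balanced:
  assumes "balR f"
  shows "balanced (via_right s) (via_right t) f"
  using assms by (simp add: balanced_def balR_def via_right_def)

lemma sumL_add: "balL f \<Longrightarrow> sumL (a + b) f = sumL a f + sumL b f"
  by (simp add: sumL_def left.coprod_add tensor_eval_tensor_add balL_balanced)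

lemma sumR_add: "balR f \<Longrightarrow> sumR (a + b) f = sumR a f + sumR b f"
  by (simp add: sumR_def right.coprod_add tensor_eval_tensor_add balR_balanced)

lemma sumL_mult:
  "balL f \<Longrightarrow> sumL (a * b) f = sumL a (\<lambda>x y. sumL b (\<lambda>u v. f (x * u) (y * v)))"
  by (simp add: sumL_def left.coprod_mult tensor_eval_tensor_mult balL_balanced)

lemma sumR_mult:
  "balR f \<Longrightarrow> sumR (a * b) f = sumR a (\<lambda>x y. sumR b (\<lambda>u v. f (x * u) (y * v)))"
  by (simp add: sumR_def right.coprod_mult tensor_eval_tensor_mult balR_balanced)

lemma sumL_one: "balL f \<Longrightarrow> sumL 1 f = f 1 1"
  by (simp add: sumL_def left.coprod_one tensor_eval_coset_of balL_balanced)

lemma sumR_one: "balR f \<Longrightarrow> sumR 1 f = f 1 1"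
  by (simp add: sumR_def right.coprod_one tensor_eval_coset_of balR_balanced)

lemma sumL_left_t: "balL f \<Longrightarrow> sumL (t r * a) f = sumL a (\<lambda>x y. f (t r * x) y)"
  using left.coprod_bimodule[of "\<pi>\<^sub>L (t r)" 1 a]
  by (simp add: sumL_def base_compat tL_one tensor_eval_tensor_map balL_balanced)

lemma sumL_left_s: "balL f \<Longrightarrow> sumL (s r * a) f = sumL a (\<lambda>x y. f x (s r * y))"
  using left.coprod_bimodule[of 1 "\<pi>\<^sub>L (s r)" a]
  by (simp add: sumL_def base_compat sL_one tensor_eval_tensor_map balL_balanced)

lemma sumR_right_t: "balR f \<Longrightarrow> sumR (a * t r) f = sumR a (\<lambda>x y. f (x * t r) y)"
  using right.coprod_bimodule[of a 1 r]
  by (simp add: sumR_def tensor_eval_tensor_map balR_balanced)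

lemma sumR_right_s: "balR f \<Longrightarrow> sumR (a * s r) f = sumR a (\<lambda>x y. f x (y * s r))"
  using right.coprod_bimodule[of a r 1]
  by (simp add: sumR_def tensor_eval_tensor_map balR_balanced)

lemma sumL_additive:
  fixes h :: "'g::ab_group_add \<Rightarrow> 'h::ab_group_add"
  assumes "\<And>a b. h (a + b) = h a + h b"
  shows "h (sumL a f) = sumL a (\<lambda>x y. h (f x y))"
  unfolding sumL_def using assms by (rule tensor_eval_additive)

lemma sumR_additive:
  fixes h :: "'g::ab_group_add \<Rightarrow> 'h::ab_group_add"
  assumes "\<And>a b. h (a + b) = h a + h b"
  shows "h (sumR a f) = sumR a (\<lambda>x y. h (f x y))"
  unfolding sumR_def using assms by (rule tensor_eval_additive)

lemma sumL_fun_add: "sumL a (\<lambda>x y. f x y + g x y) = sumL a f + sumL a g"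
  and sumR_fun_add: "sumR a (\<lambda>x y. f x y + g x y) = sumR a f + sumR a g"
  by (simp_all add: sumL_def sumR_def tensor_eval_fun_add)

lemma sumL_fun_sum: "sumL a (\<lambda>x y. \<Sum>i\<in>I. f i x y) = (\<Sum>i\<in>I. sumL a (f i))"
  and sumR_fun_sum: "sumR a (\<lambda>x y. \<Sum>i\<in>I. f i x y) = (\<Sum>i\<in>I. sumR a (f i))"
  by (simp_all add: sumL_def sumR_def tensor_eval_fun_sum)

lemma sum_swap_LL:
    "sumL a (\<lambda>x y. sumL b (\<lambda>u v. f x y u v)) = sumL b (\<lambda>u v. sumL a (\<lambda>x y. f x y u v))"
  and sum_swap_LR:
    "sumL a (\<lambda>x y. sumR b (\<lambda>u v. f x y u v)) = sumR b (\<lambda>u v. sumL a (\<lambda>x y. f x y u v))"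
  and sum_swap_RR:
    "sumR a (\<lambda>x y. sumR b (\<lambda>u v. f x y u v)) = sumR b (\<lambda>u v. sumR a (\<lambda>x y. f x y u v))"
  by (simp_all add: sumL_def sumR_def tensor_eval_swap[where X = "\<gamma>\<^sub>L a"]
      tensor_eval_swap[where X = "\<gamma>\<^sub>R a"])

lemma mult_sumL: "c * sumL a f = sumL a (\<lambda>x y. c * f x y)"
  and sumL_times: "sumL a g * c = sumL a (\<lambda>x y. g x y * c)"
  and mult_sumR: "c * sumR a f = sumR a (\<lambda>x y. c * f x y)"
  and sumR_times: "sumR a g * c = sumR a (\<lambda>x y. g x y * c)"
  for c :: "'g::ring"
  by (simp_all add: sumL_additive[where h = "\<lambda>x. c * x"] sumL_additive[where h = "\<lambda>x. x * c"]
      sumR_additive[where h = "\<lambda>x. c * x"] sumR_additive[where h = "\<lambda>x. x * c"] ring_distribs)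

lemma sumL_t: "balL f \<Longrightarrow> sumL (t r) f = f (t r) 1"
  using sumL_left_t[of f r 1] sumL_one[of "\<lambda>x y. f (t r * x) y"]
  by (simp add: balL_def biadditive_def distrib_left t_s_commute_left)

lemma balL_left_s2: "balL f \<Longrightarrow> balL (\<lambda>x y. f x (s r * y))"
  by (simp add: balL_def biadditive_def distrib_left t_s_commute_left)

lemma sumL_s: "balL f \<Longrightarrow> sumL (s r) f = f 1 (s r)"
  using sumL_left_s[of f r 1] sumL_one[of "\<lambda>x y. f x (s r * y)"] by (simp add: balL_left_s2)

lemma balR_right_t1: "balR f \<Longrightarrow> balR (\<lambda>x y. f (x * t r) y)"
proof -
  assume f: "balR f"
  have "f (x * s r' * t r) y = f (x * t r) (y * t r')" for r' x y
    using balR_bal[OF f, of "x * t r"] by (simp add: mult.assoc t_s_commute)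
  then show ?thesis
    using f by (simp add: balR_def biadditive_def distrib_right)
qed

lemma balR_right_s2: "balR f \<Longrightarrow> balR (\<lambda>x y. f x (y * s r))"
  using t_s_commute by (simp add: balR_def biadditive_def distrib_right mult.assoc)

lemma sumR_t: "balR f \<Longrightarrow> sumR (t r) f = f (t r) 1"
  using sumR_right_t[of f 1 r] sumR_one[of "\<lambda>x y. f (x * t r) y"] by (simp add: balR_right_t1)

lemma sumR_s: "balR f \<Longrightarrow> sumR (s r) f = f 1 (s r)"
  using sumR_right_s[of f 1 r] sumR_one[of "\<lambda>x y. f x (y * s r)"] by (simp add: balR_right_s2)

lemma balL_right1: "balL f \<Longrightarrow> balL (\<lambda>x y. f (x * c) y)"
  and balL_right2: "balL f \<Longrightarrow> balL (\<lambda>x y. f x (y * c))"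
  by (simp_all add: balL_def biadditive_def distrib_right mult.assoc)

lemma balR_left1: "balR f \<Longrightarrow> balR (\<lambda>x y. f (c * x) y)"
  and balR_left2: "balR f \<Longrightarrow> balR (\<lambda>x y. f x (c * y))"
  by (simp_all add: balR_def biadditive_def distrib_left flip: mult.assoc)

lemma takeuchiL:
  assumes "balL f"
  shows "sumL a (\<lambda>x y. f (x * s r) y) = sumL a (\<lambda>x y. f x (y * t (\<omega> r)))"
proof -
  let ?K = "left_tensor_null s\<^sub>L t\<^sub>L" and ?l = "\<pi>\<^sub>L (s r)"
  have "tensor_eval f (tensor_map ?K (\<lambda>x. x * t\<^sub>L ?l) (\<lambda>y. y) (\<gamma>\<^sub>L a)) =
      tensor_eval f (tensor_map ?K (\<lambda>x. x) (\<lambda>y. y * s\<^sub>L ?l) (\<gamma>\<^sub>L a))"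
    by (simp only: left.takeuchi)
  then show ?thesis
    by (simp add: sumL_def tensor_eval_tensor_map[OF balL_balanced[OF assms]]
        base_compat sL_piL_s)
qed

lemma takeuchiR:
  assumes "balR f"
  shows "sumR a (\<lambda>x y. f (s r * x) y) = sumR a (\<lambda>x y. f x (t r * y))"
proof -
  let ?K = "right_tensor_null s t"
  have "tensor_eval f (tensor_map ?K (\<lambda>x. s r * x) (\<lambda>y. y) (\<gamma>\<^sub>R a)) =
      tensor_eval f (tensor_map ?K (\<lambda>x. x) (\<lambda>y. t r * y) (\<gamma>\<^sub>R a))"
    by (simp only: right.takeuchi)
  then show ?thesis
    by (simp add: sumR_def tensor_eval_tensor_map[OF balR_balanced[OF assms]])
qed

text \<open>
  The right multiplication of \<open>A\<^sub>L \<otimes> \<^sub>LA\<close> by \<open>u \<otimes> v\<close> is not well defined for a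
  single \<open>u \<otimes> v\<close>; it becomes so, by the Takeuchi property, on the range of the coproduct.
\<close>

lemma balL_sumL_mult:
  assumes "balL f"
  shows "balL (\<lambda>u v. sumL a (\<lambda>x y. f (x * u) (y * v)))"
proof (rule balLI)
  fix r u v
  have "balL (\<lambda>x y. f (x * u) (y * v))"
    using assms by (simp add: balL_def biadditive_def distrib_right mult.assoc)
  from takeuchiL[OF this, of a r]
  show "sumL a (\<lambda>x y. f (x * (s r * u)) (y * v)) =
      sumL a (\<lambda>x y. f (x * u) (y * (t (\<omega> r) * v)))"
    by (simp add: mult.assoc)
qed (use assms in \<open>simp_all add: balL_def biadditive_def distrib_left sumL_fun_add\<close>)

lemma balR_sumR_mult:
  assumes "balR f"
  shows "balR (\<lambda>u v. sumR a (\<lambda>x y. f (u * x) (v * y)))"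
proof (rule balRI)
  fix r u v
  have "balR (\<lambda>x y. f (u * x) (v * y))"
    using assms by (simp add: balR_def biadditive_def distrib_left flip: mult.assoc)
  from takeuchiR[OF this, of a r]
  show "sumR a (\<lambda>x y. f (u * s r * x) (v * y)) = sumR a (\<lambda>x y. f (u * x) (v * t r * y))"
    by (simp add: mult.assoc)
qed (use assms in \<open>simp_all add: balR_def biadditive_def distrib_right sumR_fun_add\<close>)

lemma sumL_mult': "balL f \<Longrightarrow> sumL (a * b) f = sumL b (\<lambda>u v. sumL a (\<lambda>x y. f (x * u) (y * v)))"
  by (subst sum_swap_LL) (rule sumL_mult)

text \<open>The bimodule axiom covers only left multiplication. Here the coproduct of
  \<open>t r\<close> is \<open>t r (x) 1\<close> and that of \<open>s r\<close> is
  \<open>1 (x) s r\<close>; the factors have to be summed in the order of \<open>sumL_mult'\<close>,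
  because the map in \<open>u\<close>, \<open>v\<close> is balanced only after the sum over
  \<open>a\<close>.\<close>

lemma sumL_right_t: "balL f \<Longrightarrow> sumL (a * t r) f = sumL a (\<lambda>x y. f (x * t r) y)"
  and sumL_right_s: "balL f \<Longrightarrow> sumL (a * s r) f = sumL a (\<lambda>x y. f x (y * s r))"
  by (simp_all add: sumL_mult' sumL_t sumL_s balL_sumL_mult)

lemma sumR_left_t: "balR f \<Longrightarrow> sumR (t r * a) f = sumR a (\<lambda>x y. f (t r * x) y)"
  and sumR_left_s: "balR f \<Longrightarrow> sumR (s r * a) f = sumR a (\<lambda>x y. f x (s r * y))"
  by (simp_all add: sumR_mult sumR_t sumR_s balR_sumR_mult)

lemma counitL_left: "sumL a (\<lambda>x y. t (\<omega> (\<epsilon> x)) * y) = a"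
  using left.counit_left[of a] by (simp add: sumL_def sL_piL)

lemma counitL_right: "sumL a (\<lambda>x y. s (\<epsilon> y) * x) = a"
  using left.counit_right[of a] by (simp add: sumL_def tL_piL)

lemma counitR_left: "sumR a (\<lambda>x y. y * t (\<pi> x)) = a"
  using right.counit_left[of a] by (simp add: sumR_def)

section \<open>Coassociativity laws as identities between iterated sums\<close>

text \<open>In \<open>balLR\<close> etc. the letters name the balancing at the first and the second tensor sign.\<close>

definition balLR :: "('a \<Rightarrow> 'a \<Rightarrow> 'a \<Rightarrow> 'g::ab_group_add) \<Rightarrow> bool" where
  "balLR f \<longleftrightarrow> (\<forall>z. balL (\<lambda>x y. f x y z)) \<and> (\<forall>x. balR (\<lambda>y z. f x y z))"

definition balRL :: "('a \<Rightarrow> 'a \<Rightarrow> 'a \<Rightarrow> 'g::ab_group_add) \<Rightarrow> bool" where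
  "balRL f \<longleftrightarrow> (\<forall>z. balR (\<lambda>x y. f x y z)) \<and> (\<forall>x. balL (\<lambda>y z. f x y z))"

definition balRR :: "('a \<Rightarrow> 'a \<Rightarrow> 'a \<Rightarrow> 'g::ab_group_add) \<Rightarrow> bool" where
  "balRR f \<longleftrightarrow> (\<forall>z. balR (\<lambda>x y. f x y z)) \<and> (\<forall>x. balR (\<lambda>y z. f x y z))"

definition balLL :: "('a \<Rightarrow> 'a \<Rightarrow> 'a \<Rightarrow> 'g::ab_group_add) \<Rightarrow> bool" where
  "balLL f \<longleftrightarrow> (\<forall>z. balL (\<lambda>x y. f x y z)) \<and> (\<forall>x. balL (\<lambda>y z. f x y z))"

lemmas balanced3_iff = balanced3_def triadditive_def

lemma coassocLR:
  assumes "balLR f"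
  shows "sumR a (\<lambda>b z. sumL b (\<lambda>x y. f x y z)) = sumL a (\<lambda>x c. sumR c (\<lambda>y z. f x y z))"
proof -
  have "balanced3 (via_left t\<^sub>L) (via_left s\<^sub>L) (via_right s) (via_right t) f"
    using assms balL_balanced[of "\<lambda>x y. f x y _"] balR_balanced[of "f _"]
    by (simp add: balLR_def balanced3_iff balanced_def biadditive_def)
  from coassoc_eval[OF mixed_coassoc(1) this] show ?thesis
    by (simp add: sumL_def sumR_def)
qed

lemma coassocRL:
  assumes "balRL f"
  shows "sumL a (\<lambda>b z. sumR b (\<lambda>x y. f x y z)) = sumR a (\<lambda>x c. sumL c (\<lambda>y z. f x y z))"
proof -
  have "balanced3 (via_right s) (via_right t) (via_left t\<^sub>L) (via_left s\<^sub>L) f"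
    using assms balR_balanced[of "\<lambda>x y. f x y _"] balL_balanced[of "f _"]
    by (simp add: balRL_def balanced3_iff balanced_def biadditive_def)
  from coassoc_eval[OF mixed_coassoc(2) this] show ?thesis
    by (simp add: sumL_def sumR_def)
qed

lemma coassocRR:
  assumes "balRR f"
  shows "sumR a (\<lambda>b z. sumR b (\<lambda>x y. f x y z)) = sumR a (\<lambda>x c. sumR c (\<lambda>y z. f x y z))"
proof -
  have "balanced3 (via_right s) (via_right t) (via_right s) (via_right t) f"
    using assms balR_balanced[of "\<lambda>x y. f x y _"] balR_balanced[of "f _"]
    by (simp add: balRR_def balanced3_iff balanced_def biadditive_def)
  from coassoc_eval[OF right.coassoc this] show ?thesis
    by (simp add: sumR_def)
qed

lemma coassocLL:
  assumes "balLL f"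
  shows "sumL a (\<lambda>b z. sumL b (\<lambda>x y. f x y z)) = sumL a (\<lambda>x c. sumL c (\<lambda>y z. f x y z))"
proof -
  have "balanced3 (via_left t\<^sub>L) (via_left s\<^sub>L) (via_left t\<^sub>L) (via_left s\<^sub>L) f"
    using assms balL_balanced[of "\<lambda>x y. f x y _"] balL_balanced[of "f _"]
    by (simp add: balLL_def balanced3_iff balanced_def biadditive_def)
  from coassoc_eval[OF left.coassoc this] show ?thesis
    by (simp add: sumL_def)
qed

section \<open>The antipode\<close>

lemma S_add [simp]: "S (a + b) = S a + S b"
  using antipode_linear by (simp add: linear_map_def)

lemma S_left_t [simp]: "S (t r * a) = S a * s r"
  using antipode_right_base[of r a 1] by simp

lemma S_right_t [simp]: "S (a * t r) = s r * S a"
  using antipode_right_base[of 1 a r] by simp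

lemma S_left_s [simp]: "S (s r * a) = S a * t (\<omega> r)"
  using antipode_left_base[of "\<pi>\<^sub>L (s r)" a 1] by (simp add: base_compat sL_one tL_one sL_piL_s)

lemma S_right_s [simp]: "S (a * s r) = t (\<omega> r) * S a"
  using antipode_left_base[of 1 a "\<pi>\<^sub>L (s r)"] by (simp add: base_compat sL_one tL_one sL_piL_s)

lemma antipodeL: "sumL a (\<lambda>x y. S x * y) = s (\<pi> a)"
  using antipode_left[of a] by (simp add: sumL_def)

lemma antipodeR: "sumR a (\<lambda>x y. x * S y) = t (\<omega> (\<epsilon> a))"
  using antipode_right[of a] by (simp add: sumR_def sL_piL)

lemma balL_S: "balL (\<lambda>x y. c * S x * y * d)"
  by (rule balLI) (simp_all add: ring_distribs mult.assoc)

lemma balR_S: "balR (\<lambda>x y. c * x * S y * d)"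
  by (rule balRI) (simp_all add: ring_distribs mult.assoc)

lemma balL_S1: "balL (\<lambda>x y. S x * y)"
  using balL_S[of 1 1] by simp

lemma S_one [simp]: "S 1 = 1"
  using antipodeL[of 1] sumL_one[OF balL_S[of 1 1]] by simp

lemma S_s [simp]: "S (s r) = t (\<omega> r)"
  using S_right_s[of 1 r] by simp

lemma S_t [simp]: "S (t r) = s r"
  using S_right_t[of 1 r] by simp

lemma S_sumL: "S (sumL a f) = sumL a (\<lambda>x y. S (f x y))"
  and S_sumR: "S (sumR a f) = sumR a (\<lambda>x y. S (f x y))"
  by (simp_all add: sumL_additive[where h = S] sumR_additive[where h = S])

lemma S_counitL: "sumL a (\<lambda>x y. S x * t (\<omega> (\<epsilon> y))) = S a"
  using arg_cong[OF counitL_right[of a], of S] by (simp add: S_sumL)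

lemma S_counitR: "sumR a (\<lambda>x y. s (\<pi> x) * S y) = S a"
  using arg_cong[OF counitR_left[of a], of S] by (simp add: S_sumR)

text \<open>
  Both sides are \<open>S(a\<^sub>(\<^sub>1\<^sub>) b\<^sub>(\<^sub>1\<^sub>)) a\<^sub>(\<^sub>2\<^sub>)\<^sup>(\<^sup>1\<^sup>) b\<^sub>(\<^sub>2\<^sub>)\<^sup>(\<^sup>1\<^sup>) S(b\<^sub>(\<^sub>2\<^sub>)\<^sup>(\<^sup>2\<^sup>)) S(a\<^sub>(\<^sub>2\<^sub>)\<^sup>(\<^sup>2\<^sup>))\<close>.
\<close>

theorem S_mult [simp]: "S (a * b) = S b * S a"
proof -
  have SS: "balL (\<lambda>x y. S x * t (\<omega> (\<epsilon> y)))"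
    by (rule balLI) (simp_all add: ring_distribs mult.assoc)
  have "S (a * b) = sumL a (\<lambda>a1 a2. sumL b (\<lambda>b1 b2. S (a1 * b1) * t (\<omega> (\<epsilon> (a2 * b2)))))"
    by (simp add: S_counitL flip: sumL_mult[OF SS])
  also have "\<dots> = sumL a (\<lambda>a1 a2. sumL b (\<lambda>b1 b2.
      sumR a2 (\<lambda>x z. S (a1 * b1) * x * t (\<omega> (\<epsilon> b2)) * S z)))"
  proof -
    \<comment> \<open>In \<open>\<epsilon> (a2 * b2)\<close> the factor \<open>b2\<close> may be
      replaced by \<open>s (\<epsilon> b2)\<close>; \<open>antipodeR\<close> for
      \<open>a2 * s (\<epsilon> b2)\<close> then opens the counit, and S turns the factor
      \<open>s\<close> into \<omega>-twisted \<open>t\<close>.\<close>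
    have "t (\<omega> (\<epsilon> (a2 * b2))) = sumR a2 (\<lambda>x z. x * t (\<omega> (\<epsilon> b2)) * S z)" for a2 b2
      using antipodeR[of "a2 * s (\<epsilon> b2)"] sumR_right_s[OF balR_S[of 1 1], of a2 "\<epsilon> b2"]
      by (simp add: eps_mult_s mult.assoc)
    then show ?thesis
      by (simp add: mult_sumR mult.assoc)
  qed
  also have "\<dots> = sumL a (\<lambda>a1 a2. sumR a2 (\<lambda>x z. sumL b (\<lambda>b1 b2.
      S (a1 * b1) * x * t (\<omega> (\<epsilon> b2)) * S z)))"
    by (subst sum_swap_LR) (rule refl)
  also have "\<dots> = sumR a (\<lambda>c z. sumL c (\<lambda>a1 x. sumL b (\<lambda>b1 b2.
      S (a1 * b1) * x * t (\<omega> (\<epsilon> b2)) * S z)))"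
    by (rule coassocLR[symmetric], unfold balLR_def, intro conjI allI balLI balRI)
      (simp_all add: ring_distribs mult.assoc sumL_fun_add t_s_commute_left)
  also have "\<dots> = sumR a (\<lambda>c z. sumR b (\<lambda>y v. s (\<pi> (c * y)) * S v * S z))"
  proof -
    have "sumL c (\<lambda>a1 x. sumL b (\<lambda>b1 b2. S (a1 * b1) * x * t (\<omega> (\<epsilon> b2)) * S z)) =
      sumR b (\<lambda>y v. s (\<pi> (c * y)) * S v * S z)" for c z
    proof -
      let ?F = "\<lambda>b1 u v. sumL c (\<lambda>a1 x. S (a1 * b1) * (x * u) * (S v * S z))"
      have "balLR ?F"
        unfolding balLR_def
        by (intro conjI allI balL_sumL_mult balLI balRI)
          (simp_all add: ring_distribs mult.assoc sumL_fun_add t_s_commute_left)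
      have "sumL c (\<lambda>a1 x. sumL b (\<lambda>b1 b2. S (a1 * b1) * x * t (\<omega> (\<epsilon> b2)) * S z)) =
          sumL b (\<lambda>b1 b2. sumR b2 (\<lambda>u v. ?F b1 u v))"
        by (subst sum_swap_LL)
          (simp add: mult_sumR sumR_times sum_swap_LR[where a = c] mult.assoc flip: antipodeR)
      also have "\<dots> = sumR b (\<lambda>y v. sumL y (\<lambda>b1 u. ?F b1 u v))"
        by (rule coassocLR[symmetric]) fact
      \<comment> \<open>The inner sum is \<open>S(d_(1)) d_(2)\<close> for the product
        \<open>d = c * y\<close>, to which \<open>antipodeL\<close> applies.\<close>
      also have "\<dots> = sumR b (\<lambda>y v. s (\<pi> (c * y)) * S v * S z)"
        by (simp add: sumL_mult'[OF balL_S1] sumL_times mult.assoc flip: antipodeL)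
      finally show ?thesis .
    qed
    then show ?thesis by simp
  qed
  also have "\<dots> = sumR a (\<lambda>c z. S b * s (\<pi> c) * S z)"
  proof -
    \<comment> \<open>Since \<open>\<pi> (c * y) = \<pi> (t (\<pi> c) * y)\<close>, the left side is
      S of \<open>t (\<pi> c) * b\<close>.\<close>
    have "sumR b (\<lambda>y v. s (\<pi> (c * y)) * S v) = S b * s (\<pi> c)" for c
    proof -
      have "balR (\<lambda>y v. s (\<pi> y) * S v)"
        by (rule balRI) (simp_all add: ring_distribs mult.assoc)
      from sumR_left_t[OF this, of "\<pi> c" b] show ?thesis
        by (simp add: S_counitR pi_mult_t)
    qed
    then show ?thesis
      by (simp flip: sumR_times)
  qed
  also have "\<dots> = S b * S a"
    by (simp add: mult.assoc S_counitR flip: mult_sumR)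
  finally show ?thesis .
qed

text \<open>S turns the R-coproduct into the flipped L-coproduct. Let \<open>b\<close>,
  \<open>w\<close>, \<open>v\<close> be the legs of the iterated R-coproduct of
  \<open>a_(2)\<close>. Both sides equal the coproduct of \<open>S(a_(1)) b\<close> times
  \<open>S v (x) S w\<close>: contracting \<open>b\<close>, \<open>w\<close>, \<open>v\<close> gives
  the left side, contracting \<open>S(a_(1)) b\<close> the right one.\<close>

lemma sumL_S:
  assumes f: "balL f"
  shows "sumL (S a) f = sumR a (\<lambda>x y. f (S y) (S x))"
proof -
  define H where "H c v w = sumL c (\<lambda>p q. f (p * S v) (q * S w))" for c v w
  have bal: "balL (\<lambda>p q. f (p * c) (q * d))" for c d
    by (intro balL_right1 balL_right2 f)
  have bal1: "balL (\<lambda>p q. f (p * c) q)" for c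
    by (intro balL_right1 f)
  have f_add1: "f (x + x') y = f x y + f x' y"
    and f_add2: "f x (y + y') = f x y + f x y'" for x x' y y'
    using f by (simp_all add: balL_def biadditive_def)
  have H_add: "H (c + c') v w = H c v w + H c' v w" "H c (v + v') w = H c v w + H c v' w"
      "H c v (w + w') = H c v w + H c v w'" for c c' v v' w w'
    by (simp_all add: H_def sumL_add bal ring_distribs f_add1 f_add2 sumL_fun_add)
  have H_s: "H (c * s r) v w = H c v (w * t r)" for c r v w
    by (simp add: H_def sumL_right_s bal mult.assoc)
  \<comment> \<open>The Takeuchi property of the coproduct of \<open>c\<close> is what makes
    \<open>H\<close> balanced in \<open>w\<close>, \<open>v\<close>.\<close>
  have H_takeuchi: "H c v (w * s r) = H c (v * t r) w" for c r v w
    using takeuchiL[OF bal, of c r "S v" "S w"] by (simp add: H_def mult.assoc)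
  have H_s1: "H (s r) v w = f (S v) (S (w * t r))" for r v w
    by (simp add: H_def sumL_s bal)
  have balH1: "balR (\<lambda>c w. H c v w)" for v
    by (rule balRI) (simp_all add: H_add H_s)
  have balH2: "balR (\<lambda>w v. H c v w)" for c
    by (rule balRI) (simp_all add: H_add H_takeuchi)
  have "sumL (S a) f = sumL a (\<lambda>x z. sumL (S x * t (\<omega> (\<epsilon> z))) f)"
    using sumL_additive[of "\<lambda>c. sumL c f" a "\<lambda>x y. S x * t (\<omega> (\<epsilon> y))"] f
    by (simp add: S_counitL sumL_add)
  also have "\<dots> = sumL a (\<lambda>x z. sumR z (\<lambda>u v. sumL (S x) (\<lambda>p q. f (p * (u * S v)) q)))"
  proof -
    have "sumL c (\<lambda>p q. f (p * t (\<omega> (\<epsilon> z))) q) =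
        sumR z (\<lambda>u v. sumL c (\<lambda>p q. f (p * (u * S v)) q))" for c z
      using sumR_additive[of "\<lambda>d. sumL c (\<lambda>p q. f (p * d) q)" z "\<lambda>u v. u * S v"]
      by (simp add: ring_distribs f_add1 sumL_fun_add antipodeR)
    then show ?thesis
      by (simp add: sumL_right_t f)
  qed
  also have "\<dots> = sumL a (\<lambda>x z. sumR z (\<lambda>u v. sumR u (\<lambda>b w. H (S x * b) v w)))"
  proof -
    have "sumL c (\<lambda>p q. f (p * (u * S v)) q) = sumR u (\<lambda>b w. H (c * b) v w)" for c u v
    proof -
      let ?G = "\<lambda>u1 d w. sumL c (\<lambda>p q. f (p * u1 * S v) (q * d * S w))"
      have "balLR ?G"
        unfolding balLR_def
      proof (intro conjI allI)
        show "balL (\<lambda>u1 d. ?G u1 d w)" for w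
          by (rule balL_sumL_mult[of "\<lambda>p q. f (p * S v) (q * S w)"]) (rule bal)
        show "balR (\<lambda>d w. ?G u1 d w)" for u1
          by (rule balRI) (simp_all add: ring_distribs f_add2 sumL_fun_add mult.assoc)
      qed
      \<comment> \<open>To produce \<open>S w\<close> in the second leg, a counit is split off from
        \<open>u\<close>. As \<open>s (\<epsilon> u2)\<close> it stands directly behind
        \<open>p\<close>, so Takeuchi moves it behind \<open>q\<close> as
        \<open>t (\<omega> (\<epsilon> u2))\<close>, where \<open>antipodeR\<close> opens
        it.\<close>
      have "sumL c (\<lambda>p q. f (p * (u * S v)) q) =
          sumL u (\<lambda>u1 u2. sumL c (\<lambda>p q. f (p * s (\<epsilon> u2) * u1 * S v) q))"
        using sumL_additive[of "\<lambda>d. sumL c (\<lambda>p q. f (p * (d * S v)) q)" u "\<lambda>x y. s (\<epsilon> y) * x"]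
        by (simp add: ring_distribs f_add1 sumL_fun_add counitL_right mult.assoc)
      also have "\<dots> = sumL u (\<lambda>u1 u2. sumL c (\<lambda>p q. f (p * u1 * S v) (q * t (\<omega> (\<epsilon> u2)))))"
        using takeuchiL[OF bal1] by (simp add: mult.assoc)
      also have "\<dots> = sumL u (\<lambda>u1 u2. sumR u2 (\<lambda>d w. ?G u1 d w))"
      proof -
        have "sumL c (\<lambda>p q. f (p * u1 * S v) (q * t (\<omega> (\<epsilon> u2)))) = sumR u2 (\<lambda>d w. ?G u1 d w)"
          for u1 u2
          using sumR_additive[of "\<lambda>e. sumL c (\<lambda>p q. f (p * u1 * S v) (q * e))" u2 "\<lambda>u v. u * S v"]
          by (simp add: ring_distribs f_add2 sumL_fun_add antipodeR mult.assoc)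
        then show ?thesis by simp
      qed
      also have "\<dots> = sumR u (\<lambda>b w. sumL b (\<lambda>u1 d. ?G u1 d w))"
        by (rule coassocLR[symmetric]) fact
      also have "\<dots> = sumR u (\<lambda>b w. H (c * b) v w)"
        by (simp add: H_def sumL_mult'[OF bal])
      finally show ?thesis .
    qed
    then show ?thesis by simp
  qed
  also have "\<dots> = sumL a (\<lambda>x z. sumR z (\<lambda>b y. sumR y (\<lambda>w v. H (S x * b) v w)))"
  proof -
    have "balRR (\<lambda>b w v. H (S x * b) v w)" for x
      unfolding balRR_def using balR_left1[OF balH1] balH2 by blast
    then show ?thesis
      by (simp add: coassocRR)
  qed
  also have "\<dots> = sumR a (\<lambda>c y. sumL c (\<lambda>x b. sumR y (\<lambda>w v. H (S x * b) v w)))"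
    by (rule coassocLR[symmetric], unfold balLR_def, intro conjI allI balLI balRI)
      (simp_all add: ring_distribs mult.assoc sumR_fun_add H_add sumR_add balH2
        sumR_right_t, simp add: H_s flip: mult.assoc)
  also have "\<dots> = sumR a (\<lambda>c y. sumR (y * t (\<pi> c)) (\<lambda>w v. f (S v) (S w)))"
  proof -
    have "sumL c (\<lambda>x b. sumR y (\<lambda>w v. H (S x * b) v w)) =
        sumR y (\<lambda>w v. H (s (\<pi> c)) v w)" for c y
      using sumL_additive[of "\<lambda>e. sumR y (\<lambda>w v. H e v w)" c "\<lambda>x b. S x * b"]
      by (simp add: antipodeL H_add sumR_fun_add)
    moreover have "balR (\<lambda>w v. f (S v) (S w))"
      by (rule balRI) (simp_all add: f_add1 f_add2 balL_bal[OF f])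
    ultimately show ?thesis
      by (simp add: H_s1 sumR_right_t)
  qed
  also have "\<dots> = sumR a (\<lambda>x y. f (S y) (S x))"
  proof -
    have "balR (\<lambda>w v. f (S v) (S w))"
      by (rule balRI) (simp_all add: f_add1 f_add2 balL_bal[OF f])
    then show ?thesis
      using sumR_additive[of "\<lambda>e. sumR e (\<lambda>w v. f (S v) (S w))" a "\<lambda>x y. y * t (\<pi> x)"]
      by (simp add: sumR_add counitR_left)
  qed
  finally show ?thesis .
qed

text \<open>Mirror image of \<open>sumL_S\<close>: here \<open>s (\<pi> x)\<close> is opened by
  \<open>antipodeL\<close>, and the final contraction is by \<open>antipodeR\<close>.\<close>

lemma sumR_S:
  assumes f: "balR f"
  shows "sumR (S a) f = sumL a (\<lambda>x y. f (S y) (S x))"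
proof -
  define H where "H c v w = sumR c (\<lambda>p q. f (S w * p) (S v * q))" for c v w
  have bal: "balR (\<lambda>p q. f (c * p) (d * q))" for c d
    by (intro balR_left1 balR_left2 f)
  have bal1: "balR (\<lambda>p q. f p (c * q))" for c
    by (intro balR_left2 f)
  have f_add1: "f (x + x') y = f x y + f x' y"
    and f_add2: "f x (y + y') = f x y + f x y'" for x x' y y'
    using f by (simp_all add: balR_def biadditive_def)
  have H_add: "H (c + c') v w = H c v w + H c' v w" "H c (v + v') w = H c v w + H c v' w"
      "H c v (w + w') = H c v w + H c v w'" for c c' v v' w w'
    by (simp_all add: H_def sumR_add bal ring_distribs f_add1 f_add2 sumR_fun_add)
  have H_t: "H (t (\<omega> r) * c) v w = H c v (s r * w)" for c r v w
    by (simp add: H_def sumR_left_t bal mult.assoc)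
  have H_takeuchi: "H c (s r * v) w = H c v (t (\<omega> r) * w)" for c r v w
    using takeuchiR[OF bal, of c "S w" "\<omega> r" "S v"] by (simp add: H_def mult.assoc)
  have H_t1: "H (t (\<omega> r)) v w = f (S (s r * w)) (S v)" for r v w
    by (simp add: H_def sumR_t bal)
  have balH1: "balL (\<lambda>w c. H c v w)" for v
    by (rule balLI) (simp_all add: H_add H_t)
  have balH2: "balL (\<lambda>v w. H c v w)" for c
    by (rule balLI) (simp_all add: H_add H_takeuchi)
  have "H (c + c') = (\<lambda>v w. H c v w + H c' v w)"
      "H (t (\<omega> r) * c) = (\<lambda>v w. H c v (s r * w))" for c c' r
    by (simp_all add: H_add H_t fun_eq_iff)
  then have sum_H: "sumL x (H (c + c')) = sumL x (H c) + sumL x (H c')"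
      "sumL x (H (t (\<omega> r) * c)) = sumL x (\<lambda>v w. H c v (s r * w))" for x c c' r
    by (simp_all add: sumL_fun_add)
  have balf: "balL (\<lambda>v w. f (S w) (S v))"
    by (rule balLI) (simp_all add: f_add1 f_add2 balR_bal[OF f])
  have "sumR (S a) f = sumR a (\<lambda>x z. sumR (s (\<pi> x) * S z) f)"
    using sumR_additive[of "\<lambda>c. sumR c f" a "\<lambda>x y. s (\<pi> x) * S y"] f
    by (simp add: S_counitR sumR_add)
  also have "\<dots> = sumR a (\<lambda>x z. sumL x (\<lambda>v u. sumR (S z) (\<lambda>p q. f p (S v * u * q))))"
  proof -
    have "sumR c (\<lambda>p q. f p (s (\<pi> x) * q)) =
        sumL x (\<lambda>v u. sumR c (\<lambda>p q. f p (S v * u * q)))" for c x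
      using sumL_additive[of "\<lambda>d. sumR c (\<lambda>p q. f p (d * q))" x "\<lambda>v u. S v * u"]
      by (simp add: ring_distribs f_add2 sumR_fun_add antipodeL)
    then show ?thesis
      by (simp add: sumR_left_s f)
  qed
  also have "\<dots> = sumR a (\<lambda>x z. sumL x (\<lambda>v u. sumL u (\<lambda>w b. H (b * S z) v w)))"
  proof -
    have "sumR c (\<lambda>p q. f p (S v * u * q)) = sumL u (\<lambda>w b. H (b * c) v w)" for c u v
    proof -
      let ?G = "\<lambda>w d u1. sumR c (\<lambda>p q. f (S w * (d * p)) (S v * (u1 * q)))"
      have "balLR ?G"
        unfolding balLR_def
      proof (intro conjI allI)
        show "balR (\<lambda>d u1. ?G w d u1)" for w
          by (rule balR_sumR_mult[of "\<lambda>p q. f (S w * p) (S v * q)"]) (rule bal)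
        show "balL (\<lambda>w d. ?G w d u1)" for u1
          by (rule balLI) (simp_all add: ring_distribs f_add1 sumR_fun_add mult.assoc)
      qed
      have "sumR c (\<lambda>p q. f p (S v * u * q)) =
          sumR u (\<lambda>u2 u1. sumR c (\<lambda>p q. f p (S v * u1 * (t (\<pi> u2) * q))))"
        using sumR_additive[of "\<lambda>d. sumR c (\<lambda>p q. f p (S v * d * q))" u "\<lambda>x y. y * t (\<pi> x)"]
        by (simp add: ring_distribs f_add2 sumR_fun_add counitR_left mult.assoc)
      also have "\<dots> = sumR u (\<lambda>u2 u1. sumR c (\<lambda>p q. f (s (\<pi> u2) * p) (S v * u1 * q)))"
        using takeuchiR[OF bal1[of "S v * _"]] by (simp add: mult.assoc)
      also have "\<dots> = sumR u (\<lambda>u2 u1. sumL u2 (\<lambda>w d. ?G w d u1))"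
      proof -
        have "sumR c (\<lambda>p q. f (s (\<pi> u2) * p) (S v * u1 * q)) = sumL u2 (\<lambda>w d. ?G w d u1)"
          for u1 u2
          using sumL_additive[of "\<lambda>e. sumR c (\<lambda>p q. f (e * p) (S v * u1 * q))" u2
              "\<lambda>u v. S u * v"]
          by (simp add: ring_distribs f_add1 sumR_fun_add antipodeL mult.assoc)
        then show ?thesis by simp
      qed
      also have "\<dots> = sumL u (\<lambda>w b. sumR b (\<lambda>d u1. ?G w d u1))"
        by (rule coassocLR) fact
      also have "\<dots> = sumL u (\<lambda>w b. H (b * c) v w)"
        by (simp add: H_def sumR_mult[OF bal])
      finally show ?thesis .
    qed
    then show ?thesis by simp
  qed
  also have "\<dots> = sumR a (\<lambda>x z. sumL x (\<lambda>y b. sumL y (\<lambda>v w. H (b * S z) v w)))"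
  proof -
    have "balLL (\<lambda>v w b. H (b * S z) v w)" for z
      unfolding balLL_def using balL_right2[OF balH1] balH2 by blast
    then show ?thesis
      by (simp add: coassocLL)
  qed
  also have "\<dots> = sumL a (\<lambda>y c. sumR c (\<lambda>b z. sumL y (\<lambda>v w. H (b * S z) v w)))"
    by (rule coassocLR, unfold balLR_def, intro conjI allI balLI balRI)
      (simp_all add: ring_distribs mult.assoc sumL_add balH2 sumL_left_s sum_H)
  also have "\<dots> = sumL a (\<lambda>y c. sumL (s (\<epsilon> c) * y) (\<lambda>v w. f (S w) (S v)))"
  proof -
    have "sumR c (\<lambda>b z. sumL y (\<lambda>v w. H (b * S z) v w)) =
        sumL y (\<lambda>v w. H (t (\<omega> (\<epsilon> c))) v w)" for c y
      using sumR_additive[of "\<lambda>e. sumL y (\<lambda>v w. H e v w)" c "\<lambda>b z. b * S z"]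
      by (simp add: antipodeR H_add sumL_fun_add)
    then show ?thesis
      by (simp add: H_t1 sumL_left_s balf)
  qed
  also have "\<dots> = sumL a (\<lambda>x y. f (S y) (S x))"
    using sumL_additive[of "\<lambda>e. sumL e (\<lambda>v w. f (S w) (S v))" a "\<lambda>x y. s (\<epsilon> y) * x"]
    by (simp add: sumL_add balf counitL_right)
  finally show ?thesis .
qed

section \<open>Integrals\<close>

abbreviation \<L> :: "('a \<Rightarrow> 'r) set" where "\<L> \<equiv> left_s_integrals s t \<gamma>\<^sub>R"

lemma integral_iff:
  "\<phi> \<in> \<L> \<longleftrightarrow> (\<forall>a b. \<phi> (a + b) = \<phi> a + \<phi> b) \<and> (\<forall>a r. \<phi> (a * s r) = \<phi> a * r) \<and>
    (\<forall>a. sumR a (\<lambda>x y. y * t (\<phi> x)) = s (\<phi> a))"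
  by (auto simp: left_s_integrals_def right_dual_def sumR_def)

lemma integral_add: "\<phi> \<in> \<L> \<Longrightarrow> \<phi> (a + b) = \<phi> a + \<phi> b"
  and integral_right_s: "\<phi> \<in> \<L> \<Longrightarrow> \<phi> (a * s r) = \<phi> a * r"
  and integral_sumR: "\<phi> \<in> \<L> \<Longrightarrow> sumR a (\<lambda>x y. y * t (\<phi> x)) = s (\<phi> a)"
  by (simp_all add: integral_iff)

lemma balR_dual:
  assumes "\<And>a b. \<phi> (a + b) = \<phi> a + \<phi> b" and "\<And>a r. \<phi> (a * s r) = \<phi> a * r"
  shows "balR (\<lambda>x y. y * t (\<phi> x))"
  by (rule balRI) (simp_all add: assms ring_distribs mult.assoc)

text \<open>Left linearity is not part of the definition. It follows because \<open>s r\<close>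
  passes into the second leg of the R-coproduct and can be pulled out of the sum, and
  \<open>s\<close> is injective.\<close>

lemma integral_left_s:
  assumes "\<phi> \<in> \<L>"
  shows "\<phi> (s r * a) = r * \<phi> a"
proof -
  have "balR (\<lambda>x y. y * t (\<phi> x))"
    using assms by (intro balR_dual) (simp_all add: integral_iff)
  then have "s (\<phi> (s r * a)) = s r * s (\<phi> a)"
    using assms by (simp add: sumR_left_s mult.assoc flip: integral_sumR mult_sumR)
  then show ?thesis
    by (simp add: s_inject flip: s_mult)
qed

lemma balL_left_dual:
  assumes "\<And>a b. \<phi> (a + b) = \<phi> a + \<phi> b" and "\<And>a r. \<phi> (s r * a) = r * \<phi> a"
  shows "balL (\<lambda>x y. t (\<omega> (\<phi> x)) * y)"
  by (rule balLI) (simp_all add: assms ring_distribs mult.assoc)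

lemma balL_eps: "balL (\<lambda>x y. t (\<omega> (\<epsilon> x)) * y)"
  by (rule balL_left_dual) simp_all

text \<open>By mixed coassociativity the map \<open>a |-> a^(2) t(\<phi>(a^(1)))\<close> acts on the
  first leg of the L-coproduct only. The counit of the left bialgebroid therefore recovers it from
  its composite with \<epsilon>.\<close>

lemma sumL_eps_sumR:
  assumes "\<And>a b. \<phi> (a + b) = \<phi> a + \<phi> b" and "\<And>a r. \<phi> (a * s r) = \<phi> a * r"
  shows "sumL a (\<lambda>x y. t (\<omega> (\<epsilon> (sumR x (\<lambda>u v. v * t (\<phi> u))))) * y) =
    sumR a (\<lambda>u v. v * t (\<phi> u))"
proof -
  let ?f = "\<lambda>u v z. t (\<omega> (\<epsilon> (v * t (\<phi> u)))) * z"
  have "balRL ?f"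
    using assms unfolding balRL_def
    by (intro conjI allI balRI balLI) (simp_all add: ring_distribs mult.assoc)
  have "t (\<omega> (\<epsilon> (sumR x (\<lambda>u v. v * t (\<phi> u))))) * y = sumR x (\<lambda>u v. ?f u v y)" for x y
    using sumR_additive[of "\<lambda>c. t (\<omega> (\<epsilon> c)) * y" x "\<lambda>u v. v * t (\<phi> u)"]
    by (simp add: ring_distribs)
  then have "sumL a (\<lambda>x y. t (\<omega> (\<epsilon> (sumR x (\<lambda>u v. v * t (\<phi> u))))) * y) =
      sumL a (\<lambda>x y. sumR x (\<lambda>u v. ?f u v y))"
    by simp
  also have "\<dots> = sumR a (\<lambda>u c. sumL c (\<lambda>v y. ?f u v y))"
    by (rule coassocRL) fact
  also have "\<dots> = sumR a (\<lambda>u c. c * t (\<phi> u))"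
    by (simp add: counitL_left flip: sumL_right_t[OF balL_eps])
  finally show ?thesis .
qed

text \<open>For an integral the map in \<open>sumL_eps_sumR\<close> is \<open>s\<close> after
  \<phi>, and \<epsilon> undoes \<open>s\<close>.\<close>

lemma integral_sumL:
  assumes "\<phi> \<in> \<L>"
  shows "sumL a (\<lambda>x y. t (\<omega> (\<phi> x)) * y) = s (\<phi> a)"
  using sumL_eps_sumR[of \<phi> a] assms by (simp add: integral_iff)

text \<open>Converse of \<open>integral_sumL\<close>, needed because the trace functionals are
  computed with the L-coproduct. Right linearity comes from moving \<open>s r\<close> into the
  second leg; then \<open>\<phi> x = \<pi> (s (\<phi> x))\<close> is expanded by the hypothesis, and
  mixed coassociativity with the right counit gives the R-form.\<close>

lemma integralI:
  assumes add: "\<And>a b. \<phi> (a + b) = \<phi> a + \<phi> b"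
    and left: "\<And>r a. \<phi> (s r * a) = r * \<phi> a"
    and int: "\<And>a. sumL a (\<lambda>x y. t (\<omega> (\<phi> x)) * y) = s (\<phi> a)"
  shows "\<phi> \<in> \<L>"
proof -
  have bal: "balL (\<lambda>x y. t (\<omega> (\<phi> x)) * y)"
    using add left by (rule balL_left_dual)
  have "s (\<phi> (a * s r)) = s (\<phi> a) * s r" for a r
    by (simp add: sumL_right_s[OF bal] sumL_times mult.assoc flip: int)
  then have right: "\<phi> (a * s r) = \<phi> a * r" for a r
    by (simp add: s_inject flip: s_mult)
  have "sumR a (\<lambda>x y. y * t (\<phi> x)) = s (\<phi> a)" for a
  proof -
    let ?f = "\<lambda>u v y. y * t (\<pi> (t (\<omega> (\<phi> u)) * v))"
    have "\<pi> (x * (v * s r)) = \<pi> (x * v) * r" for x v r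
      using pi_right_s[of "x * v" r] by (simp add: mult.assoc)
    then have "balLR ?f"
      unfolding balLR_def
      by (intro conjI allI balRI balLI) (simp_all add: add left ring_distribs mult.assoc)
    have pi_counit: "balR (\<lambda>v y. y * t (\<pi> v))"
      by (rule balR_dual) simp_all
    have "y * t (\<phi> x) = sumL x (\<lambda>u v. ?f u v y)" for x y
      using sumL_additive[of "\<lambda>c. y * t (\<pi> c)" x "\<lambda>u v. t (\<omega> (\<phi> u)) * v"]
      by (simp add: int ring_distribs)
    then have "sumR a (\<lambda>x y. y * t (\<phi> x)) = sumR a (\<lambda>x y. sumL x (\<lambda>u v. ?f u v y))"
      by simp
    also have "\<dots> = sumL a (\<lambda>u c. sumR c (\<lambda>v y. ?f u v y))"
      by (rule coassocLR) fact
    also have "\<dots> = sumL a (\<lambda>u c. t (\<omega> (\<phi> u)) * c)"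
      by (simp add: counitR_left flip: sumR_left_t[OF pi_counit])
    finally show ?thesis
      by (simp add: int)
  qed
  with add right show ?thesis
    by (simp add: integral_iff)
qed

text \<open>Multiplicativity and mixed coassociativity bring together the two R-legs of
  \<open>x_(2)\<close>, which contract to a counit; Takeuchi carries it back to
  \<open>x_(1)\<close>, restoring \<open>x\<close>. The lemma is applied to integrals in one
  direction of the theorem and to the functionals \<open>\<psi> i\<close> in the other.\<close>

lemma sumR_mult_S:
  assumes \<phi>: "\<And>a b. \<phi> (a + b) = \<phi> a + \<phi> b" "\<And>r a. \<phi> (s r * a) = r * \<phi> a"
  shows "sumR x (\<lambda>p q. sumL (h * p) (\<lambda>y z. t (\<omega> (\<phi> y)) * z) * S q) =
    sumL h (\<lambda>y z. t (\<omega> (\<phi> (y * x))) * z)"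
proof -
  have balL0: "balL (\<lambda>x y. t (\<omega> (\<phi> x)) * y)"
    using \<phi> by (rule balL_left_dual)
  let ?F = "\<lambda>p u q. sumL h (\<lambda>y z. t (\<omega> (\<phi> (y * p))) * (z * u) * S q)"
  have "balLR ?F"
    unfolding balLR_def
  proof (intro conjI allI)
    show "balL (\<lambda>p u. ?F p u q)" for q
      using balL_sumL_mult[OF balL0, of h]
      by (auto simp: balL_def biadditive_def ring_distribs sumL_fun_add simp flip: sumL_times)
    show "balR (\<lambda>u q. ?F p u q)" for p
      by (rule balRI) (simp_all add: ring_distribs sumL_fun_add mult.assoc)
  qed
  have "sumR x (\<lambda>p q. sumL (h * p) (\<lambda>y z. t (\<omega> (\<phi> y)) * z) * S q) =
      sumR x (\<lambda>p q. sumL p (\<lambda>p1 p2. ?F p1 p2 q))"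
    by (simp add: sumL_mult'[OF balL0] sumL_times)
  also have "\<dots> = sumL x (\<lambda>p c. sumR c (\<lambda>u q. ?F p u q))"
    by (rule coassocLR) fact
  also have "\<dots> = sumL x (\<lambda>p c. sumL h (\<lambda>y z. t (\<omega> (\<phi> (y * s (\<epsilon> c) * p))) * z))"
  proof -
    have "sumR c (\<lambda>u q. ?F p u q) = sumL h (\<lambda>y z. t (\<omega> (\<phi> (y * p))) * (z * t (\<omega> (\<epsilon> c))))"
      for p c
      by (simp add: mult.assoc mult_sumR flip: antipodeR sum_swap_LR)
    moreover have "sumL h (\<lambda>y z. t (\<omega> (\<phi> (y * p))) * (z * t (\<omega> r))) =
        sumL h (\<lambda>y z. t (\<omega> (\<phi> (y * s r * p))) * z)" for p r
      using takeuchiL[OF balL_right1[OF balL0], of h r p] by simp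
    ultimately show ?thesis
      by simp
  qed
  also have "\<dots> = sumL h (\<lambda>y z. t (\<omega> (\<phi> (y * x))) * z)"
    using sumL_additive[of "\<lambda>c. sumL h (\<lambda>y z. t (\<omega> (\<phi> (y * c))) * z)" x "\<lambda>x y. s (\<epsilon> y) * x"]
    by (simp add: counitL_right \<phi> ring_distribs sumL_fun_add mult.assoc)
  finally show ?thesis .
qed

text \<open>Evaluation on a representative \<open>X\<close> of an element of \<open>\<^sup>RA \<otimes> \<L>(\<A>\<^sup>*)\<^sup>R\<close>\<close>

definition balI :: "('a \<Rightarrow> ('a \<Rightarrow> 'r) \<Rightarrow> 'g::ab_group_add) \<Rightarrow> bool" where
  "balI f \<longleftrightarrow> (\<forall>x x'. \<forall>\<phi>\<in>\<L>. f (x + x') \<phi> = f x \<phi> + f x' \<phi>) \<and>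
     (\<forall>x. \<forall>\<phi>\<in>\<L>. \<forall>\<psi>\<in>\<L>. f x (\<phi> + \<psi>) = f x \<phi> + f x \<psi>) \<and>
     (\<forall>r x. \<forall>\<phi>\<in>\<L>. f (x * t r) \<phi> = f x (dual_act t r \<phi>))"

definition evalI :: "('a \<Rightarrow> ('a \<Rightarrow> 'r) \<Rightarrow> 'g::ab_group_add) \<Rightarrow> ('a \<times> ('a \<Rightarrow> 'r) \<Rightarrow>\<^sub>0 int) \<Rightarrow> 'g"
  where "evalI f X = frag_eval (\<lambda>p. f (fst p) (snd p)) X"

lemma evalI_cong:
  assumes "Poly_Mapping.keys X \<subseteq> UNIV \<times> \<L>" and "\<And>x \<phi>. \<phi> \<in> \<L> \<Longrightarrow> f x \<phi> = g x \<phi>"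
  shows "evalI f X = evalI g X"
  unfolding evalI_def using assms by (intro frag_eval_cong) auto

lemma evalI_rep:
  assumes "balI f"
  shows "tensor_eval f (coset (tensor_null UNIV \<L> (via_right t) (dual_act t)) X) = evalI f X"
proof -
  have "frag_eval (\<lambda>p. f (fst p) (snd p)) z = 0"
    if "z \<in> tensor_null UNIV \<L> (via_right t) (dual_act t)" for z
    by (rule frag_eval_tensor_null[where f = f, OF _ _ _ that];
        use assms in \<open>unfold balI_def via_right_def, blast\<close>)
  then show ?thesis
    unfolding tensor_eval_eq evalI_def tensor_null_def by (intro frag_eval_rep_coset) auto
qed

lemma evalI_additive:
  fixes h :: "'g::ab_group_add \<Rightarrow> 'h::ab_group_add"
  assumes "\<And>a b. h (a + b) = h a + h b"
  shows "h (evalI f X) = evalI (\<lambda>x \<phi>. h (f x \<phi>)) X"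
  unfolding evalI_def by (rule frag_eval_additive) fact

lemma evalI_sumL: "evalI (\<lambda>x \<phi>. sumL a (\<lambda>y z. f x \<phi> y z)) X = sumL a (\<lambda>y z. evalI (\<lambda>x \<phi>. f x \<phi> y z) X)"
  and evalI_sumR: "evalI (\<lambda>x \<phi>. sumR a (\<lambda>y z. f x \<phi> y z)) X = sumR a (\<lambda>y z. evalI (\<lambda>x \<phi>. f x \<phi> y z) X)"
  unfolding evalI_def sumL_def sumR_def tensor_eval_eq by (rule frag_eval_swap)+

lemma evalI_fun_add: "evalI (\<lambda>x \<phi>. f x \<phi> + g x \<phi>) X = evalI f X + evalI g X"
  unfolding evalI_def by (rule frag_eval_fun_add)

lemma invariant_evalI:
  assumes "coset (tensor_null UNIV \<L> (via_right t) (dual_act t)) X \<in>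
      invariants s\<^sub>L \<pi>\<^sub>L (integral_tensor s t \<gamma>\<^sub>R) (integral_tensor_act s t \<gamma>\<^sub>R)"
    and f: "balI f"
  shows "evalI (\<lambda>x. f (a * x)) X = evalI (\<lambda>x. f (t (\<omega> (\<epsilon> a)) * x)) X"
proof -
  let ?K = "tensor_null UNIV \<L> (via_right t) (dual_act t)"
  have "tensor_eval f (integral_tensor_act s t \<gamma>\<^sub>R c (coset ?K X)) = evalI (\<lambda>x. f (c * x)) X" for c
  proof -
    have "balI (\<lambda>x. f (c * x))"
      using f by (simp add: balI_def ring_distribs flip: mult.assoc)
    then show ?thesis
      unfolding integral_tensor_act_def tensor_map_def induced_def
      using evalI_rep[of "\<lambda>x. f (c * x)" X] evalI_rep[OF f]
      by (simp add: tensor_eval_eq evalI_def frag_eval_extend case_prod_unfold)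
  qed
  then show ?thesis
    using assms(1) by (simp add: invariants_def sL_piL) metis
qed

section \<open>From invariants to the inverse of the antipode\<close>

theorem bij_S_of_invariant:
  assumes inv: "n \<in> invariants s\<^sub>L \<pi>\<^sub>L (integral_tensor s t \<gamma>\<^sub>R) (integral_tensor_act s t \<gamma>\<^sub>R)"
    and norm: "tensor_eval (\<lambda>x \<phi>. \<phi> x) n = 1"
  shows "bij S"
proof -
  obtain X where X: "Poly_Mapping.keys X \<subseteq> UNIV \<times> \<L>"
    and n: "n = coset (tensor_null UNIV \<L> (via_right t) (dual_act t)) X"
    using inv by (auto simp: invariants_def integral_tensor_def tensor_def)
  note invX = invariant_evalI[OF inv[unfolded n]]
  have bal_ev: "balI (\<lambda>x \<phi>. \<phi> x)"
    by (simp add: balI_def integral_add dual_act_def)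
  have one: "evalI (\<lambda>x \<phi>. \<phi> x) X = 1"
    using norm evalI_rep[OF bal_ev] by (simp add: n)
  \<comment> \<open>The elements \<open>a\<close> and \<open>s (\<epsilon> a)\<close> have the same
    \<epsilon>, hence act alike on the invariant; for the latter, left linearity of the integrals
    and the normalization apply.\<close>
  have eval: "evalI (\<lambda>x \<phi>. \<phi> (a * x)) X = \<epsilon> a" for a
  proof -
    have s: "evalI (\<lambda>x \<phi>. \<phi> (s r * x)) X = r" for r
    proof -
      have "evalI (\<lambda>x \<phi>. \<phi> (s r * x)) X = evalI (\<lambda>x \<phi>. r * \<phi> x) X"
        by (intro evalI_cong X integral_left_s)
      also have "\<dots> = r"
        using evalI_additive[of "\<lambda>c. r * c" "\<lambda>x \<phi>. \<phi> x" X] by (simp add: one distrib_left)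
      finally show ?thesis .
    qed
    show ?thesis
      using invX[OF bal_ev, of a] invX[OF bal_ev, of "s (\<epsilon> a)"] by (simp add: s)
  qed

  \<comment> \<open>A two-variable form of the candidate inverse, which will be
    \<open>V h 1\<close>. The second slot gives the element \<open>a\<close> a place to go when
    \<open>S a\<close> is removed from the first.\<close>
  define W where "W u v x \<phi> = sumR x (\<lambda>p q. v * (q * t (\<phi> (u * p))))" for u v x and \<phi> :: "'a \<Rightarrow> 'r"
  have balR0: "balR (\<lambda>p q. q * t (\<phi> p))" if "\<phi> \<in> \<L>" for \<phi>
    using that by (intro balR_dual) (simp_all add: integral_iff)
  have balR1: "balR (\<lambda>p q. v * (q * t (\<phi> (u * p))))" if "\<phi> \<in> \<L>" for \<phi> u v
    using balR_left1[OF balR_left2[OF balR0[OF that]]] by (simp add: mult.assoc)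
  have balW: "balR (\<lambda>u v. W u v x \<phi>)" if "\<phi> \<in> \<L>" for x \<phi>
    using balR_sumR_mult[OF balR0[OF that], of x] by (simp add: W_def mult.assoc)
  have balI_W: "balI (\<lambda>x \<phi>. W u v x \<phi>)" for u v
    unfolding balI_def
    by (auto simp: W_def sumR_add balR1 sumR_right_t dual_act_def mult.assoc
        ring_distribs sumR_fun_add)
  define V where "V u v = evalI (\<lambda>x \<phi>. W u v x \<phi>) X" for u v
  have V_add: "V (u + u') v = V u v + V u' v" "V u (v + v') = V u v + V u v'" for u u' v v'
    unfolding V_def evalI_fun_add[symmetric]
    by (intro evalI_cong X; simp add: balR_add1[OF balW] balR_add2[OF balW])+
  have V_bal: "V (u * s r) v = V u (v * t r)" for u v r
    unfolding V_def by (intro evalI_cong X) (rule balR_bal[OF balW])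
  \<comment> \<open>The one use of invariance for \<open>V\<close>: the factor
    \<open>t (\<omega> (\<epsilon> a))\<close> in front of the first tensor factors may be replaced
    by \<open>a\<close>, whose coproduct then spreads over both slots.\<close>
  have V_t: "V (u * t (\<omega> (\<epsilon> a))) v = sumR a (\<lambda>c d. V (u * c) (v * d))" for u v a
  proof -
    have "V (u * t (\<omega> (\<epsilon> a))) v = evalI (\<lambda>x \<phi>. W u v (t (\<omega> (\<epsilon> a)) * x) \<phi>) X"
      unfolding V_def by (intro evalI_cong X) (simp add: W_def sumR_left_t balR1 mult.assoc)
    also have "\<dots> = evalI (\<lambda>x \<phi>. W u v (a * x) \<phi>) X"
      by (simp add: invX[OF balI_W, of _ _ a])
    also have "\<dots> = evalI (\<lambda>x \<phi>. sumR a (\<lambda>c d. W (u * c) (v * d) x \<phi>)) X"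
      by (intro evalI_cong X) (simp add: W_def sumR_mult balR1 mult.assoc)
    also have "\<dots> = sumR a (\<lambda>c d. V (u * c) (v * d))"
      by (simp add: V_def evalI_sumR)
    finally show ?thesis .
  qed
  have V_s: "V (s r) v = V 1 (v * t r)" for r v
    using V_bal[of 1] by simp
  \<comment> \<open>Write \<open>S a\<close> as
    \<open>S(a_(1)) t(\<omega>(\<epsilon>(a_(2))))\<close>, open the counit by \<open>V_t\<close>,
    and contract \<open>S(a_(1))\<close> with the first R-leg of \<open>a_(2)\<close>.\<close>
  have V_S: "V (S a) 1 = V 1 a" for a
  proof -
    have "V (S a) 1 = sumL a (\<lambda>x y. V (S x * t (\<omega> (\<epsilon> y))) 1)"
      using sumL_additive[of "\<lambda>c. V c 1" a "\<lambda>x y. S x * t (\<omega> (\<epsilon> y))"]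
      by (simp add: V_add S_counitL)
    also have "\<dots> = sumL a (\<lambda>x y. sumR y (\<lambda>c d. V (S x * c) d))"
      by (simp add: V_t)
    also have "\<dots> = sumR a (\<lambda>b d. sumL b (\<lambda>x c. V (S x * c) d))"
      by (rule coassocLR[symmetric], unfold balLR_def, intro conjI allI balLI balRI)
        (simp_all add: V_add ring_distribs mult.assoc, simp add: V_bal flip: mult.assoc)
    also have "\<dots> = sumR a (\<lambda>b d. V 1 (d * t (\<pi> b)))"
      using sumL_additive[of "\<lambda>c. V c _" _ "\<lambda>x c. S x * c"] by (simp add: V_add antipodeL V_s)
    also have "\<dots> = V 1 a"
      using sumR_additive[of "\<lambda>c. V 1 c" a "\<lambda>x y. y * t (\<pi> x)"] by (simp add: V_add counitR_left)
    finally show ?thesis .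
  qed
  have V_1: "V 1 a = a" for a
  proof -
    have "V 1 a = evalI (\<lambda>x \<phi>. a * s (\<phi> x)) X"
      unfolding V_def
      by (intro evalI_cong X) (simp add: W_def mult.assoc integral_sumR flip: mult_sumR)
    also have "\<dots> = a * s (evalI (\<lambda>x \<phi>. \<phi> x) X)"
      by (rule evalI_additive[symmetric]) (simp add: distrib_left)
    finally show ?thesis
      by (simp add: one)
  qed
  have "inj S"
    by (rule inj_on_inverseI[of _ "\<lambda>h. V h 1"]) (simp add: V_S V_1)

  \<comment> \<open>The integral property in its L-form makes \<open>sumR_mult_S\<close> applicable;
    what remains of the invariant is \<open>eval\<close>, and the left counit gives
    \<open>h\<close>.\<close>
  have "S (V h 1) = h" for h
  proof -
    have "S (V h 1) = evalI (\<lambda>x \<phi>. S (W h 1 x \<phi>)) X"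
      unfolding V_def by (rule evalI_additive) simp
    also have "\<dots> = evalI (\<lambda>x \<phi>. sumL h (\<lambda>y z. t (\<omega> (\<phi> (y * x))) * z)) X"
    proof (intro evalI_cong X)
      fix x \<phi> assume \<phi>: "\<phi> \<in> \<L>"
      have "S (W h 1 x \<phi>) = sumR x (\<lambda>p q. sumL (h * p) (\<lambda>y z. t (\<omega> (\<phi> y)) * z) * S q)"
        by (simp add: W_def S_sumR integral_sumL[OF \<phi>])
      also have "\<dots> = sumL h (\<lambda>y z. t (\<omega> (\<phi> (y * x))) * z)"
        using \<phi> by (intro sumR_mult_S) (simp_all add: integral_add integral_left_s)
      finally show "S (W h 1 x \<phi>) = sumL h (\<lambda>y z. t (\<omega> (\<phi> (y * x))) * z)" .
    qed
    also have "\<dots> = sumL h (\<lambda>y z. t (\<omega> (evalI (\<lambda>x \<phi>. \<phi> (y * x)) X)) * z)"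
      by (simp add: evalI_sumL evalI_additive[of "\<lambda>c. t (\<omega> c) * _"] ring_distribs)
    also have "\<dots> = h"
      by (simp add: eval counitL_left)
    finally show ?thesis .
  qed
  then have "surj S"
    by (rule surjI)
  with \<open>inj S\<close> show ?thesis
    by (rule bijI)
qed

text \<open>The elements of \<open>Hom\<^sub>R(\<^sup>RA, R)\<close>\<close>

definition dual_map :: "('a \<Rightarrow> 'r) \<Rightarrow> bool" where
  "dual_map \<eta> \<longleftrightarrow> (\<forall>a a'. \<eta> (a + a') = \<eta> a + \<eta> a') \<and> (\<forall>a r. \<eta> (a * t r) = r * \<eta> a)"

section \<open>From the inverse of the antipode to invariants\<close>

lemma integral_zero: "0 \<in> \<L>"
proof -
  have "t 0 = 0" "s 0 = 0"
    using t_add[of 0 0] s_add[of 0 0] by simp_all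
  then show ?thesis
    by (simp add: integral_iff sumR_def tensor_eval_eq)
qed

lemma integral_plus: "\<phi> \<in> \<L> \<Longrightarrow> \<psi> \<in> \<L> \<Longrightarrow> \<phi> + \<psi> \<in> \<L>"
  by (simp add: integral_iff ring_distribs sumR_fun_add)

lemma integral_dual_act:
  assumes "\<phi> \<in> \<L>"
  shows "dual_act t r \<phi> \<in> \<L>"
proof -
  have "balR (\<lambda>x y. y * t (\<phi> x))"
    using assms by (intro balR_dual) (simp_all add: integral_iff)
  from sumR_right_t[OF this]
  have "sumR a (\<lambda>x y. y * t (\<phi> (x * t r))) = s (\<phi> (a * t r))" for a
    using assms by (simp add: integral_sumR)
  moreover have "\<phi> (a * s r' * t r) = \<phi> (a * t r) * r'" for a r'
    using integral_right_s[OF assms, of "a * t r" r'] by (simp add: mult.assoc t_s_commute)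
  ultimately show ?thesis
    using assms by (simp add: integral_iff dual_act_def ring_distribs)
qed

definition \<rho> :: "'r \<Rightarrow> 'r" where "\<rho> = inv \<omega>"

lemma omega_rho [simp]: "\<omega> (\<rho> r) = r"
  and rho_omega [simp]: "\<rho> (\<omega> r) = r"
  using bij_omega by (simp_all add: \<rho>_def bij_is_inj bij_is_surj surj_f_inv_f)

lemma balR_times: "balR f \<Longrightarrow> balR (\<lambda>x y. f x y * c)"
  for f :: "'a \<Rightarrow> 'a \<Rightarrow> 'g::ring"
  by (simp add: balR_def biadditive_def distrib_right)

lemma rho_mult: "\<rho> (r * r') = \<rho> r * \<rho> r'"
  using rho_omega[of "\<rho> r * \<rho> r'"] by (simp del: rho_omega)

lemma eps_right_t': "\<epsilon> (a * t r) = \<epsilon> (a * s (\<rho> r))"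
  using eps_right_t[of a "\<rho> r"] by simp

context
  assumes bij: "bij S"
begin

definition \<sigma> :: "'a \<Rightarrow> 'a" where "\<sigma> = inv S"

lemma S_sigma [simp]: "S (\<sigma> a) = a"
  and sigma_S [simp]: "\<sigma> (S a) = a"
  using bij by (simp_all add: \<sigma>_def bij_is_inj bij_is_surj surj_f_inv_f)

lemma sigma_eq: "S b = a \<Longrightarrow> \<sigma> a = b"
  by auto

lemma sigma_add [simp]: "\<sigma> (a + b) = \<sigma> a + \<sigma> b"
  and sigma_mult [simp]: "\<sigma> (a * b) = \<sigma> b * \<sigma> a"
  and sigma_one [simp]: "\<sigma> 1 = 1"
  and sigma_s [simp]: "\<sigma> (s r) = t r"
  and sigma_t [simp]: "\<sigma> (t r) = s (\<rho> r)"
  by (rule sigma_eq, simp)+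

lemma sumR_sigma: "sumR a (\<lambda>x y. y * \<sigma> x) = s (\<epsilon> a)"
proof -
  have "S (sumR a (\<lambda>x y. y * \<sigma> x)) = S (s (\<epsilon> a))"
    by (simp add: S_sumR antipodeR)
  then show ?thesis
    by (metis sigma_S)
qed

lemma sumL_sigma: "sumL a (\<lambda>x y. \<sigma> y * x) = t (\<pi> a)"
proof -
  have "S (sumL a (\<lambda>x y. \<sigma> y * x)) = S (t (\<pi> a))"
    by (simp add: S_sumL antipodeL)
  then show ?thesis
    by (metis sigma_S)
qed

lemma balR_sigma: "balR (\<lambda>x y. y * \<sigma> x)"
  by (rule balRI) (simp_all add: ring_distribs mult.assoc)

context
  fixes I :: "'i set" and b :: "'i \<Rightarrow> 'a" and \<beta> :: "'i \<Rightarrow> 'a \<Rightarrow> 'r"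
  assumes finite_I: "finite I"
    and basis: "\<And>a. (\<Sum>i\<in>I. b i * s (\<beta> i a)) = a"
    and beta_add: "\<And>i a a'. \<beta> i (a + a') = \<beta> i a + \<beta> i a'"
    and beta_right: "\<And>i a r. \<beta> i (a * s r) = \<beta> i a * r"
begin

text \<open>
  \<open>F i\<close> is an endomorphism of the right \<open>\<A>\<^sub>L\<close>-comodule \<open>A\<close>. These endomorphisms correspond both to
  right \<open>R\<close>-linear functionals (here \<open>\<beta> i\<close>) and to left \<open>R\<close>-linear ones (here \<open>\<psi> i\<close>, see
  \<open>sumL_psi\<close>).
\<close>

definition F :: "'i \<Rightarrow> 'a \<Rightarrow> 'a" where
  "F i h = sumR h (\<lambda>x y. y * t (\<beta> i x))"

definition \<psi> :: "'i \<Rightarrow> 'a \<Rightarrow> 'r" where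
  "\<psi> i h = \<epsilon> (F i h)"

lemma bal_beta: "balR (\<lambda>x y. y * t (\<beta> i x))"
  by (rule balR_dual) (simp_all add: beta_add beta_right)

lemma F_add: "F i (h + h') = F i h + F i h'"
  and F_right_s: "F i (h * s r) = F i h * s r"
  and F_left_s: "F i (s r * h) = s r * F i h"
  by (simp_all add: F_def sumR_add bal_beta sumR_right_s sumR_left_s sumR_times mult_sumR
      mult.assoc t_s_commute)

text \<open>Normalization by \<open>mult.assoc\<close> nests products to the right and hides the
  trailing \<open>s r\<close> from \<open>F_right_s\<close>; this form and the next one match the
  nested products.\<close>

lemma F_right_s2: "F i (h * (a * s r)) = F i (h * a) * s r"
  using F_right_s[of i "h * a" r] by (simp add: mult.assoc)

lemma F_right_s3: "F i (h * (a * (c * s r))) = F i (h * (a * c)) * s r"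
  using F_right_s2[of i h "a * c" r] by (simp add: mult.assoc)

lemma psi_add: "\<psi> i (h + h') = \<psi> i h + \<psi> i h'"
  and psi_left_s: "\<psi> i (s r * h) = r * \<psi> i h"
  by (simp_all add: \<psi>_def F_add F_left_s)

lemma sumL_psi: "sumL h (\<lambda>x y. t (\<omega> (\<psi> i x)) * y) = F i h"
  unfolding \<psi>_def F_def by (rule sumL_eps_sumR) (simp_all add: beta_add beta_right)

lemma sumL_psi_mult:
  "sumL h (\<lambda>x z. t (\<omega> (\<psi> i (x * y))) * z) = sumR y (\<lambda>u v. F i (h * u) * S v)"
  by (simp add: psi_add psi_left_s sumL_psi flip: sumR_mult_S)

text \<open>The operator under the trace. The coproduct of \<open>\<sigma> a\<close> is used instead
  of that of \<open>a\<close>, so that right multiplication of \<open>a\<close> by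
  \<open>s r\<close> becomes left multiplication of \<open>\<sigma> a\<close> by \<open>t r\<close>,
  and \<open>Y \<eta>\<close> is \<rho>-semilinear.\<close>

definition Y :: "('a \<Rightarrow> 'r) \<Rightarrow> 'a \<Rightarrow> 'a" where
  "Y \<eta> a = sumR (\<sigma> a) (\<lambda>x y. t (\<eta> y) * \<sigma> x)"

definition E :: "('a \<Rightarrow> 'r) \<Rightarrow> 'a \<Rightarrow> 'r" where
  "E \<eta> h = (\<Sum>i\<in>I. \<psi> i (h * Y \<eta> (b i)))"

lemma bal_Y: "dual_map \<eta> \<Longrightarrow> balR (\<lambda>x y. t (\<eta> y) * \<sigma> x)"
  by (rule balRI) (simp_all add: dual_map_def ring_distribs mult.assoc)

lemma Y_add: "dual_map \<eta> \<Longrightarrow> Y \<eta> (a + a') = Y \<eta> a + Y \<eta> a'"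
  by (simp add: Y_def sumR_add bal_Y)

lemma Y_right_s: "dual_map \<eta> \<Longrightarrow> Y \<eta> (a * s r) = Y \<eta> a * s (\<rho> r)"
  by (simp add: Y_def sumR_left_t bal_Y sumR_times mult.assoc)

lemma Y_zero: "dual_map \<eta> \<Longrightarrow> Y \<eta> 0 = 0"
  using Y_add[of \<eta> 0 0] by simp

lemma Y_sum: "dual_map \<eta> \<Longrightarrow> Y \<eta> (\<Sum>i\<in>J. f i) = (\<Sum>i\<in>J. Y \<eta> (f i))"
  by (induction J rule: infinite_finite_induct) (simp_all add: Y_add Y_zero)

lemma Y_expand: "dual_map \<eta> \<Longrightarrow> Y \<eta> a = (\<Sum>k\<in>I. Y \<eta> (b k) * s (\<rho> (\<beta> k a)))"
  using Y_sum[of \<eta> "\<lambda>k. b k * s (\<beta> k a)" I] by (simp add: basis Y_right_s)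

lemma E_add: "E \<eta> (h + h') = E \<eta> h + E \<eta> h'"
  and E_left_s: "E \<eta> (s r * h) = r * E \<eta> h"
  by (simp_all add: E_def ring_distribs psi_add psi_left_s mult.assoc sum.distrib sum_distrib_left)

text \<open>A trace is cyclic: the coproduct of \<open>Y \<eta> (b i)\<close> is traded for that of
  \<open>b i\<close> (\<open>step\<close>), the leg under \<open>Y \<eta>\<close> is expanded in the
  basis (\<open>trace\<close>), and after exchanging the two sums the old index is contracted
  (\<open>inner\<close>), leaving a trace over the new index.\<close>

lemma sumL_E:
  assumes \<eta>: "dual_map \<eta>"
  shows "sumL h (\<lambda>x z. t (\<omega> (E \<eta> x)) * z) = s (E \<eta> h)"
proof -
  \<comment> \<open>The R-coproduct of \<open>\<sigma> p\<close> is obtained from the L-coproduct of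
    \<open>p = S (\<sigma> p)\<close> by \<open>sumL_S\<close>, and \<open>sumR_S\<close> for
    \<open>c = S (\<sigma> c)\<close> leads back at the end. In between, mixed coassociativity
    collects the legs that form \<open>Y \<eta>\<close>.\<close>
  have step: "sumR (Y \<eta> c) (\<lambda>u v. F i (h * u) * S v) =
      sumR c (\<lambda>P Q. F i (h * Y \<eta> P) * \<sigma> Q)" for i c
  proof -
    define G where "G u v = F i (h * u) * S v" for u v
    have balG: "balR (\<lambda>u v. G (x * u) v)" for x
      unfolding G_def by (rule balRI)
        (simp_all add: ring_distribs mult.assoc F_add F_right_s3)
    then have balG1: "balR G"
      using balG[of 1] by simp
    let ?f = "\<lambda>p1 p2 q. F i (h * (t (\<eta> q) * \<sigma> p2)) * p1"
    have bal_f: "balL (\<lambda>p1 p2. ?f p1 p2 q)" for q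
      by (rule balLI) (simp_all add: ring_distribs F_add mult.assoc F_right_s3)
    have "sumR (Y \<eta> c) G = sumR (\<sigma> c) (\<lambda>p q. sumR (t (\<eta> q) * \<sigma> p) G)"
      using sumR_additive[of "\<lambda>d. sumR d G" "\<sigma> c" "\<lambda>x y. t (\<eta> y) * \<sigma> x"]
      by (simp add: Y_def sumR_add balG1)
    also have "\<dots> = sumR (\<sigma> c) (\<lambda>p q. sumL p (\<lambda>p1 p2. ?f p1 p2 q))"
    proof -
      have "sumR (t (\<eta> q) * \<sigma> p) G = sumL p (\<lambda>p1 p2. ?f p1 p2 q)" for p q
        using sumL_S[OF bal_f, of "\<sigma> p" q]
        by (simp add: sumR_left_t[OF balG1]) (simp add: G_def)
      then show ?thesis by simp
    qed
    also have "\<dots> = sumL (\<sigma> c) (\<lambda>p1 d. sumR d (\<lambda>p2 q. ?f p1 p2 q))"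
    proof (rule coassocLR, unfold balLR_def, intro conjI allI)
      show "balR (\<lambda>p2 q. ?f p1 p2 q)" for p1
        using \<eta> by (intro balRI) (simp_all add: dual_map_def ring_distribs F_add mult.assoc)
    qed (rule bal_f)
    also have "\<dots> = sumL (\<sigma> c) (\<lambda>x y. F i (h * Y \<eta> (S y)) * x)"
    proof -
      have "sumR d (\<lambda>p2 q. ?f p1 p2 q) = F i (h * Y \<eta> (S d)) * p1" for p1 d
        using sumR_additive[of "\<lambda>e. F i (h * e) * p1" d "\<lambda>x y. t (\<eta> y) * \<sigma> x"]
        by (simp add: Y_def F_add ring_distribs)
      then show ?thesis by simp
    qed
    also have "\<dots> = sumR (S (\<sigma> c)) (\<lambda>P Q. F i (h * Y \<eta> P) * \<sigma> Q)"
    proof -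
      have "balR (\<lambda>P Q. F i (h * Y \<eta> P) * \<sigma> Q)"
        using \<eta> by (intro balRI)
          (simp_all add: Y_add Y_right_s F_add ring_distribs F_right_s2 mult.assoc)
      from sumR_S[OF this, of "\<sigma> c"] show ?thesis
        by (simp del: S_sigma)
    qed
    finally show ?thesis
      by (simp add: G_def[abs_def])
  qed
  have trace: "(\<Sum>i\<in>I. sumR (b i) (\<lambda>P Q. F i (h * Y \<eta> P) * \<sigma> Q)) =
      (\<Sum>k\<in>I. \<Sum>i\<in>I. F i (h * Y \<eta> (b k)) * \<sigma> (F k (b i)))"
  proof -
    have "sumR (b i) (\<lambda>P Q. F i (h * Y \<eta> P) * \<sigma> Q) =
        (\<Sum>k\<in>I. F i (h * Y \<eta> (b k)) * \<sigma> (F k (b i)))" for i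
    proof -
      have F_sum: "F i (\<Sum>k\<in>I. f k) = (\<Sum>k\<in>I. F i (f k))" for f
        using finite_I F_add[of i 0 0] by (induction I rule: finite_induct) (simp_all add: F_add)
      have *: "F i (h * Y \<eta> P) = (\<Sum>k\<in>I. F i (h * Y \<eta> (b k)) * s (\<rho> (\<beta> k P)))" for P
        by (subst Y_expand[OF \<eta>]) (simp add: sum_distrib_left F_sum F_right_s2)
      have "sumR (b i) (\<lambda>P Q. F i (h * Y \<eta> P) * \<sigma> Q) = sumR (b i)
          (\<lambda>P Q. (\<Sum>k\<in>I. F i (h * Y \<eta> (b k)) * s (\<rho> (\<beta> k P))) * \<sigma> Q)"
        by (rule arg_cong[of _ _ "sumR (b i)"], intro ext, subst *, rule refl)
      also have "\<dots> = (\<Sum>k\<in>I. sumR (b i) (\<lambda>P Q. F i (h * Y \<eta> (b k)) * \<sigma> (Q * t (\<beta> k P))))"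
        by (simp add: sum_distrib_right sumR_fun_sum mult.assoc)
      also have "\<dots> = (\<Sum>k\<in>I. F i (h * Y \<eta> (b k)) * \<sigma> (F k (b i)))"
        using sumR_additive[of "\<lambda>c. _ * \<sigma> c" "b i" "\<lambda>P Q. Q * t (\<beta> _ P)"]
        by (simp add: F_def ring_distribs del: sigma_mult)
      finally show ?thesis .
    qed
    then show ?thesis
      by simp (rule sum.swap)
  qed
  \<comment> \<open>The factor \<open>t (\<beta> i x)\<close> of \<open>F i g\<close> is absorbed
    into \<sigma> as \<open>s (\<beta> i x)\<close> behind \<open>b i\<close>, so the sum over
    \<open>i\<close> restores the leg \<open>x\<close> of \<open>g\<close>; coassociativity and
    \<open>sumR_sigma\<close> finish.\<close>
  have inner: "(\<Sum>i\<in>I. F i g * \<sigma> (F k (b i))) = s (\<psi> k g)" for k g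
  proof -
    have F_sum: "F k (\<Sum>i\<in>I. f i) = (\<Sum>i\<in>I. F k (f i))" for f
      using finite_I F_add[of k 0 0] by (induction I rule: finite_induct) (simp_all add: F_add)
    have sigma_sum: "\<sigma> (\<Sum>i\<in>I. f i) = (\<Sum>i\<in>I. \<sigma> (f i))" for f
      using finite_I sigma_add[of 0 0] by (induction I rule: finite_induct) simp_all
    have "F i g * \<sigma> (F k (b i)) = sumR g (\<lambda>x y. y * \<sigma> (F k (b i * s (\<beta> i x))))" for i
      by (simp add: F_def[of i] sumR_times F_right_s mult.assoc)
    then have "(\<Sum>i\<in>I. F i g * \<sigma> (F k (b i))) =
        sumR g (\<lambda>x y. y * \<sigma> (F k (\<Sum>i\<in>I. b i * s (\<beta> i x))))"
      by (simp add: F_sum sigma_sum sum_distrib_left del: sigma_mult flip: sumR_fun_sum)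
    also have "\<dots> = sumR g (\<lambda>x y. sumR x (\<lambda>u v. y * \<sigma> (v * t (\<beta> k u))))"
      using sumR_additive[of "\<lambda>c. _ * \<sigma> c" _ "\<lambda>P Q. Q * t (\<beta> k P)"]
      by (simp add: basis F_def ring_distribs del: sigma_mult)
    also have "\<dots> = sumR g (\<lambda>u c. sumR c (\<lambda>v y. y * \<sigma> (v * t (\<beta> k u))))"
      by (rule coassocRR, unfold balRR_def, intro conjI allI balRI)
        (simp_all add: beta_add beta_right ring_distribs mult.assoc t_s_commute_left
          rho_mult)
    also have "\<dots> = sumR g (\<lambda>u c. s (\<epsilon> (c * t (\<beta> k u))))"
      by (simp only: sumR_right_t[OF balR_sigma] flip: sumR_sigma)
    also have "\<dots> = s (\<epsilon> (F k g))"
      unfolding F_def by (rule sumR_additive[symmetric]) simp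
    finally show ?thesis
      by (simp add: \<psi>_def)
  qed
  have "sumL h (\<lambda>x z. t (\<omega> (E \<eta> x)) * z) =
      (\<Sum>i\<in>I. sumL h (\<lambda>x z. t (\<omega> (\<psi> i (x * Y \<eta> (b i)))) * z))"
  proof -
    have 0: "t (\<omega> 0) = 0"
      using t_add[of 0 0] omega_add[of 0 0] by simp
    have "t (\<omega> (\<Sum>i\<in>I. f i)) = (\<Sum>i\<in>I. t (\<omega> (f i)))" for f
      using finite_I by (induction I rule: finite_induct) (simp_all add: 0)
    then show ?thesis
      by (simp add: E_def sum_distrib_right sumL_fun_sum)
  qed
  also have "\<dots> = (\<Sum>k\<in>I. s (\<psi> k (h * Y \<eta> (b k))))"
    by (simp add: sumL_psi_mult step trace inner)
  also have "\<dots> = s (E \<eta> h)"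
  proof -
    have "s (\<Sum>i\<in>I. f i) = (\<Sum>i\<in>I. s (f i))" for f
      using finite_I s_add[of 0 0] by (induction I rule: finite_induct) simp_all
    then show ?thesis
      by (simp add: E_def)
  qed
  finally show ?thesis .
qed

lemma E_integral: "dual_map \<eta> \<Longrightarrow> E \<eta> \<in> \<L>"
  by (rule integralI) (simp_all add: E_add E_left_s sumL_E)

section \<open>Invariance and normalization\<close>

lemma dual_map_mult: "dual_map \<eta> \<Longrightarrow> dual_map (\<lambda>x. \<eta> (a * x))"
proof -
  assume "dual_map \<eta>"
  then have \<eta>: "\<eta> (x + y) = \<eta> x + \<eta> y" "\<eta> (x * t r) = r * \<eta> x" for x y r
    by (simp_all add: dual_map_def)
  show ?thesis
    using \<eta>(2)[of "a * _"] by (simp add: dual_map_def distrib_left \<eta>(1) mult.assoc)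
qed

text \<open>Since \<open>\<sigma> (c * S y) = y * \<sigma> c\<close>, the right side involves the
  coproduct of \<open>y = a_(2)\<close>. Its first leg contracts with \<open>a_(1)\<close> by
  \<open>sumL_sigma\<close>, and Takeuchi moves the resulting counit to the second leg, restoring
  \<open>a\<close>.\<close>

lemma Y_mult:
  assumes \<eta>: "dual_map \<eta>"
  shows "Y (\<lambda>x. \<eta> (a * x)) c = sumL a (\<lambda>x y. Y \<eta> (c * S y) * x)"
proof -
  have \<eta>_add: "\<eta> (x + y) = \<eta> x + \<eta> y" for x y
    using \<eta> by (simp add: dual_map_def)
  let ?f = "\<lambda>x p q. sumR (\<sigma> c) (\<lambda>u v. t (\<eta> (q * v)) * (\<sigma> u * (\<sigma> p * x)))"
  have "sumL a (\<lambda>x y. Y \<eta> (c * S y) * x) = sumL a (\<lambda>x y. sumR y (\<lambda>p q. ?f x p q))"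
    by (simp add: Y_def sumR_mult bal_Y \<eta> sumR_times mult.assoc)
  also have "\<dots> = sumR a (\<lambda>z q. sumL z (\<lambda>x p. ?f x p q))"
  proof (rule coassocLR[symmetric], unfold balLR_def, intro conjI allI)
    show "balL (\<lambda>x p. ?f x p q)" for q
      by (rule balLI) (simp_all add: ring_distribs sumR_fun_add mult.assoc)
    show "balR (\<lambda>p q. ?f x p q)" for x
      using balR_times[OF balR_sumR_mult[OF bal_Y[OF \<eta>], of "\<sigma> c"], of x]
      by (simp add: sumR_times mult.assoc)
  qed
  also have "\<dots> = sumR a (\<lambda>z q. sumR (\<sigma> c) (\<lambda>u v. t (\<eta> (q * t (\<pi> z) * v)) * \<sigma> u))"
  proof -
    have "sumL z (\<lambda>x p. ?f x p q) = sumR (\<sigma> c) (\<lambda>u v. t (\<eta> (q * t (\<pi> z) * v)) * \<sigma> u)" for z q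
    proof -
      have "sumL z (\<lambda>x p. ?f x p q) = sumR (\<sigma> c) (\<lambda>u v. t (\<eta> (q * v)) * \<sigma> (s (\<pi> z) * u))"
        by (simp add: sum_swap_LR[of z] sumL_sigma flip: mult_sumL)
      also have "\<dots> = sumR (\<sigma> c) (\<lambda>u v. t (\<eta> (q * (t (\<pi> z) * v))) * \<sigma> u)"
        by (rule takeuchiR[OF bal_Y[OF dual_map_mult[OF \<eta>]]])
      finally show ?thesis
        by (simp add: mult.assoc)
    qed
    then show ?thesis by simp
  qed
  also have "\<dots> = Y (\<lambda>x. \<eta> (a * x)) c"
    using sumR_additive[of "\<lambda>d. sumR (\<sigma> c) (\<lambda>u v. t (\<eta> (d * v)) * \<sigma> u)" a "\<lambda>x y. y * t (\<pi> x)"]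
    by (simp add: Y_def counitR_left \<eta>_add ring_distribs sumR_fun_add)
  finally show ?thesis ..
qed

text \<open>Once all legs are written with R-coproducts, the sum over \<open>i\<close> removes the
  basis and assembles \<open>F j\<close> at \<open>g a^(1) S(a^(2))\<close>; there
  \<open>antipodeR\<close> replaces \<open>a\<close> by its counit.\<close>

lemma sum_psi_trace:
  "(\<Sum>i\<in>I. sumL a (\<lambda>x y. \<psi> i (g * s (\<rho> (\<beta> j (b i * S y))) * x))) = \<psi> j (g * t (\<omega> (\<epsilon> a)))"
proof -
  have beta_s: "\<beta> j (x * (y * s r)) = \<beta> j (x * y) * r" for x y r
    using beta_right[of j "x * y" r] by (simp add: mult.assoc)
  \<comment> \<open>The scalar \<open>r\<close> will depend on the other leg of the coproduct of
    \<open>a\<close>. It is moved from the middle of the argument to the far right, behind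
    \<open>S v\<close>, where that leg can be joined with \<open>v\<close> into one
    coproduct.\<close>
  have psi_eq: "\<psi> i (g * s (\<rho> r) * x) = sumR x (\<lambda>u v. \<epsilon> (F i (g * u) * (S v * t r)))" for i r x
  proof -
    have bal: "balL (\<lambda>p q. t (\<omega> (\<psi> i (p * x))) * q)"
      by (rule balL_left_dual) (simp_all add: psi_add psi_left_s ring_distribs mult.assoc)
    have eps: "\<epsilon> (sumL y (\<lambda>p q. t (\<omega> (\<psi> i (p * x))) * q)) = \<psi> i (y * x)" for y
    proof -
      have "\<epsilon> (sumL y (\<lambda>p q. t (\<omega> (\<psi> i (p * x))) * q)) = sumL y (\<lambda>p q. \<psi> i (s (\<epsilon> q) * p * x))"
        by (subst sumL_additive[where h = \<epsilon>]) (simp_all add: psi_left_s mult.assoc)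
      also have "\<dots> = \<psi> i (y * x)"
        using sumL_additive[of "\<lambda>c. \<psi> i (c * x)" y "\<lambda>p q. s (\<epsilon> q) * p"]
        by (simp add: counitL_right psi_add ring_distribs)
      finally show ?thesis .
    qed
    have "\<psi> i (g * s (\<rho> r) * x) =
        \<epsilon> (sumL (g * s (\<rho> r)) (\<lambda>p q. t (\<omega> (\<psi> i (p * x))) * q))"
      by (rule eps[symmetric])
    also have "\<dots> = \<epsilon> (sumL g (\<lambda>p q. t (\<omega> (\<psi> i (p * x))) * q) * s (\<rho> r))"
      by (simp add: sumL_right_s[OF bal] sumL_times mult.assoc)
    also have "\<dots> = \<epsilon> (sumR x (\<lambda>u v. F i (g * u) * S v) * t r)"
      by (simp add: sumL_psi_mult eps_right_t')
    also have "\<dots> = sumR x (\<lambda>u v. \<epsilon> (F i (g * u) * (S v * t r)))"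
      by (subst sumR_additive[where h = "\<lambda>c. \<epsilon> (c * t r)"]) (simp_all add: ring_distribs mult.assoc)
    finally show ?thesis .
  qed
  let ?f = "\<lambda>i u v y. \<epsilon> (F i (g * u) * (S v * t (\<beta> j (b i * S y))))"
  let ?h = "\<lambda>i u P Q. \<epsilon> (F i (g * u) * (Q * t (\<beta> j (b i * P))))"
  have bal_h: "balR (\<lambda>P Q. ?h i u P Q)" for i u
    by (rule balRI) (simp_all add: ring_distribs beta_add beta_s mult.assoc)
  have "sumL a (\<lambda>x y. \<psi> i (g * s (\<rho> (\<beta> j (b i * S y))) * x)) =
      sumR a (\<lambda>u c. sumR (S c) (\<lambda>P Q. ?h i u P Q))" for i
  proof -
    have "balRL (?f i)"
      unfolding balRL_def
      by (intro conjI allI balRI balLI)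
        (simp_all add: ring_distribs beta_add beta_s F_add F_right_s2 mult.assoc)
    have "sumL a (\<lambda>x y. \<psi> i (g * s (\<rho> (\<beta> j (b i * S y))) * x)) =
        sumL a (\<lambda>x y. sumR x (\<lambda>u v. ?f i u v y))"
      by (simp only: psi_eq)
    also have "\<dots> = sumR a (\<lambda>u c. sumL c (\<lambda>v y. ?f i u v y))"
      by (rule coassocRL) fact
    also have "\<dots> = sumR a (\<lambda>u c. sumR (S c) (\<lambda>P Q. ?h i u P Q))"
      by (simp add: sumR_S[OF bal_h])
    finally show ?thesis .
  qed
  then have "(\<Sum>i\<in>I. sumL a (\<lambda>x y. \<psi> i (g * s (\<rho> (\<beta> j (b i * S y))) * x))) =
      sumR a (\<lambda>u c. \<Sum>i\<in>I. sumR (S c) (\<lambda>P Q. ?h i u P Q))"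
    by (simp add: sumR_fun_sum)
  also have "\<dots> = sumR a (\<lambda>u c. \<psi> j (g * (u * S c)))"
  proof -
    have "(\<Sum>i\<in>I. sumR c (\<lambda>P Q. ?h i u P Q)) = \<psi> j (g * (u * c))" for u c
    proof -
      have bal: "balR (\<lambda>P Q. \<epsilon> (q * (Q * t (\<beta> j (d * P)))))" for d q
        by (rule balRI) (simp_all add: ring_distribs beta_add beta_s mult.assoc)
      \<comment> \<open>Unfolding \<open>F i\<close> puts \<open>t (\<beta> i p)\<close> in front of
        \<open>Q\<close>; Takeuchi moves it in front of \<open>P\<close> as
        \<open>s (\<beta> i p)\<close>, directly behind \<open>b i\<close>, so that the sum over
        \<open>i\<close> yields \<open>p\<close>.\<close>
      have "sumR c (\<lambda>P Q. ?h i u P Q) = sumR (g * u) (\<lambda>p q.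
          sumR c (\<lambda>P Q. \<epsilon> (q * (Q * t (\<beta> j (b i * s (\<beta> i p) * P))))))" for i
      proof -
        have "sumR c (\<lambda>P Q. ?h i u P Q) = sumR (g * u) (\<lambda>p q.
            sumR c (\<lambda>P Q. \<epsilon> (q * ((t (\<beta> i p) * Q) * t (\<beta> j (b i * P))))))"
          unfolding F_def
          by (subst sum_swap_RR, intro arg_cong[of _ _ "sumR c"] ext,
              subst sumR_additive[where h = "\<lambda>d. \<epsilon> (d * _)"])
            (simp_all add: ring_distribs mult.assoc)
        also have "\<dots> = sumR (g * u) (\<lambda>p q.
            sumR c (\<lambda>P Q. \<epsilon> (q * (Q * t (\<beta> j (b i * (s (\<beta> i p) * P)))))))"
          by (simp only: takeuchiR[OF bal, symmetric])
        finally show ?thesis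
          by (simp add: mult.assoc)
      qed
      then have "(\<Sum>i\<in>I. sumR c (\<lambda>P Q. ?h i u P Q)) = sumR (g * u) (\<lambda>p q.
          sumR c (\<lambda>P Q. \<Sum>i\<in>I. \<epsilon> (q * (Q * t (\<beta> j (b i * s (\<beta> i p) * P))))))"
        by (simp add: sumR_fun_sum)
      also have "\<dots> = sumR (g * u) (\<lambda>p q. sumR c (\<lambda>P Q. \<epsilon> (q * (Q * t (\<beta> j (p * P))))))"
      proof -
        have "(\<Sum>i\<in>J. \<epsilon> (q * (Q * t (\<beta> j (f i * P))))) = \<epsilon> (q * (Q * t (\<beta> j ((\<Sum>i\<in>J. f i) * P))))"
          if "finite J" for f :: "'i \<Rightarrow> 'a" and q Q P and J
        proof -
          have zero: "\<beta> j 0 = 0" "t 0 = 0" "\<epsilon> 0 = 0"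
            using beta_add[of j 0 0] t_add[of 0 0] eps_add[of 0 0] by simp_all
          show ?thesis
            using that
            by (induction J rule: finite_induct) (simp_all add: ring_distribs beta_add zero)
        qed
        from this[OF finite_I, of _ _ "\<lambda>i. b i * s (\<beta> i _)"] show ?thesis
          by (simp add: basis)
      qed
      also have "\<dots> = sumR (g * u * c) (\<lambda>p q. \<epsilon> (q * t (\<beta> j p)))"
      proof -
        have "balR (\<lambda>p q. \<epsilon> (q * t (\<beta> j p)))"
          by (rule balRI) (simp_all add: ring_distribs beta_add beta_right mult.assoc)
        from sumR_mult[OF this, of "g * u" c] show ?thesis
          by (simp add: mult.assoc)
      qed
      also have "\<dots> = \<psi> j (g * (u * c))"
        by (simp add: \<psi>_def F_def mult.assoc sumR_additive[where h = \<epsilon>])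
      finally show ?thesis .
    qed
    then show ?thesis by simp
  qed
  also have "\<dots> = \<psi> j (g * t (\<omega> (\<epsilon> a)))"
    using sumR_additive[of "\<lambda>c. \<psi> j (g * c)" a "\<lambda>u c. u * S c"]
    by (simp add: psi_add ring_distribs antipodeR)
  finally show ?thesis .
qed

text \<open>\<open>Y_mult\<close>, an expansion of \<open>Y \<eta> (b i * S y)\<close> in the basis,
  and \<open>sum_psi_trace\<close>. The point is that the right side depends on \<open>a\<close>
  only through \<open>\<epsilon> a\<close>, which is the source of invariance.\<close>

lemma E_mult:
  assumes \<eta>: "dual_map \<eta>"
  shows "E (\<lambda>x. \<eta> (a * x)) h = (\<Sum>j\<in>I. \<psi> j (h * Y \<eta> (b j) * t (\<omega> (\<epsilon> a))))"
proof -
  have psi_sum: "\<psi> i (\<Sum>j\<in>I. f j) = (\<Sum>j\<in>I. \<psi> i (f j))" for i f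
    using finite_I psi_add[of i 0 0] by (induction I rule: finite_induct) (simp_all add: psi_add)
  have "\<psi> i (h * Y (\<lambda>x. \<eta> (a * x)) (b i)) =
      (\<Sum>j\<in>I. sumL a (\<lambda>x y. \<psi> i (h * Y \<eta> (b j) * s (\<rho> (\<beta> j (b i * S y))) * x)))" for i
  proof -
    have "\<psi> i (h * Y (\<lambda>x. \<eta> (a * x)) (b i)) = sumL a (\<lambda>x y. \<psi> i (h * (Y \<eta> (b i * S y) * x)))"
      unfolding Y_mult[OF \<eta>]
      by (rule sumL_additive[where h = "\<lambda>c. \<psi> i (h * c)"]) (simp add: psi_add distrib_left)
    also have "\<dots> = sumL a (\<lambda>x y. \<psi> i (h *
        ((\<Sum>j\<in>I. Y \<eta> (b j) * s (\<rho> (\<beta> j (b i * S y)))) * x)))"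
      by (rule arg_cong[of _ _ "sumL a"], intro ext, subst Y_expand[OF \<eta>], rule refl)
    finally show ?thesis
      by (simp add: sum_distrib_left sum_distrib_right psi_sum sumL_fun_sum mult.assoc)
  qed
  then have "E (\<lambda>x. \<eta> (a * x)) h = (\<Sum>j\<in>I. \<Sum>i\<in>I.
      sumL a (\<lambda>x y. \<psi> i (h * Y \<eta> (b j) * s (\<rho> (\<beta> j (b i * S y))) * x)))"
    unfolding E_def by simp (rule sum.swap)
  then show ?thesis
    by (simp only: sum_psi_trace)
qed

text \<open>The basis \<open>c\<close> cancels the \<eta> inside \<open>Y\<close>, leaving
  \<open>s (\<epsilon> (\<sigma> (b i)))\<close> by \<open>sumR_sigma\<close>. By left linearity
  only \<open>\<psi> i 1 = \<rho> (\<beta> i 1)\<close> is then needed, and these are the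
  coordinates of 1.\<close>

lemma E_dual_basis:
  assumes J: "finite J" and c: "\<And>a. (\<Sum>j\<in>J. c j * t (\<eta> j a)) = a"
    and \<eta>: "\<And>j. j \<in> J \<Longrightarrow> dual_map (\<eta> j)"
  shows "(\<Sum>j\<in>J. E (\<eta> j) (c j)) = 1"
proof -
  have psi_sum: "\<psi> i (\<Sum>j\<in>J. f j) = (\<Sum>j\<in>J. \<psi> i (f j))" for i f
    using J psi_add[of i 0 0] by (induction J rule: finite_induct) (simp_all add: psi_add)
  have "(\<Sum>j\<in>J. c j * Y (\<eta> j) a) = s (\<epsilon> (\<sigma> a))" for a
  proof -
    have "(\<Sum>j\<in>J. c j * Y (\<eta> j) a) = sumR (\<sigma> a) (\<lambda>x y. (\<Sum>j\<in>J. c j * t (\<eta> j y)) * \<sigma> x)"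
      by (simp add: Y_def mult_sumR sumR_fun_sum sum_distrib_right mult.assoc)
    then show ?thesis
      by (simp add: c sumR_sigma)
  qed
  then have "(\<Sum>j\<in>J. E (\<eta> j) (c j)) = (\<Sum>i\<in>I. \<psi> i (s (\<epsilon> (\<sigma> (b i)))))"
    unfolding E_def by (subst sum.swap) (simp flip: psi_sum)
  also have "\<dots> = (\<Sum>i\<in>I. \<epsilon> (\<sigma> (b i * s (\<beta> i 1))))"
  proof -
    have "\<psi> i 1 = \<rho> (\<beta> i 1)" for i
      using eps_t[of "\<rho> (\<beta> i 1)"] by (simp add: \<psi>_def F_def sumR_one bal_beta del: eps_t)
    moreover have "\<epsilon> (t r * x) = \<epsilon> x * \<rho> r" for r x
      using eps_left_t[of "\<rho> r" x] by simp
    ultimately show ?thesis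
      using psi_left_s[of _ _ 1] by simp
  qed
  also have "\<dots> = \<epsilon> (\<sigma> (\<Sum>i\<in>I. b i * s (\<beta> i 1)))"
    using finite_I eps_add[of 0 0] sigma_add[of 0 0]
    by (induction I rule: finite_induct) (simp_all del: sigma_mult)
  finally show ?thesis
    by (simp add: basis)
qed

text \<open>The functional \<open>\<theta> (a * x)\<close> is the sum of
  \<open>\<eta> j x * \<theta> (a * c j)\<close> over \<open>j\<close>; under \<open>Y\<close> and
  \<open>E\<close> the coefficients \<open>\<theta> (a * c j)\<close> become the right action on
  integrals.\<close>

lemma E_dual_act:
  assumes J: "finite J" and c: "\<And>a. (\<Sum>j\<in>J. c j * t (\<eta> j a)) = a"
    and \<theta>: "dual_map \<theta>"
  shows "(\<Sum>j\<in>J. dual_act t (\<theta> (a * c j)) (E (\<eta> j))) = E (\<lambda>x. \<theta> (a * x))"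
proof
  fix h
  have psi_sum: "\<psi> i (\<Sum>j\<in>J. f j) = (\<Sum>j\<in>J. \<psi> i (f j))" for i f
    using J psi_add[of i 0 0] by (induction J rule: finite_induct) (simp_all add: psi_add)
  have t_sum: "t (\<Sum>j\<in>J. f j) = (\<Sum>j\<in>J. t (f j))" for f
    using J t_add[of 0 0] by (induction J rule: finite_induct) simp_all
  have \<theta>_sum: "\<theta> (\<Sum>j\<in>J. f j) = (\<Sum>j\<in>J. \<theta> (f j))" for f
    using J \<theta> dual_map_def[of \<theta>]
    by (induction J rule: finite_induct) (simp_all, metis add_cancel_right_right)
  have Y: "(\<Sum>j\<in>J. t (\<theta> (a * c j)) * Y (\<eta> j) x) = Y (\<lambda>x. \<theta> (a * x)) x" for x
  proof -
    have "(\<Sum>j\<in>J. t (\<theta> (a * c j)) * t (\<eta> j y)) = t (\<theta> (a * y))" for y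
    proof -
      have "(\<Sum>j\<in>J. t (\<theta> (a * c j)) * t (\<eta> j y)) = t (\<theta> (\<Sum>j\<in>J. a * c j * t (\<eta> j y)))"
        using \<theta> by (simp add: t_sum \<theta>_sum dual_map_def)
      also have "(\<Sum>j\<in>J. a * c j * t (\<eta> j y)) = a * y"
        by (simp add: mult.assoc c flip: sum_distrib_left)
      finally show ?thesis .
    qed
    then show ?thesis
      by (simp add: Y_def mult_sumR sumR_fun_sum mult.assoc flip: sumR_fun_sum)
        (simp flip: mult.assoc sum_distrib_right)
  qed
  have "(\<Sum>j\<in>J. f j) h = (\<Sum>j\<in>J. f j h)" for f :: "_ \<Rightarrow> 'a \<Rightarrow> 'r"
    using J by (induction J rule: finite_induct) simp_all
  then have "(\<Sum>j\<in>J. dual_act t (\<theta> (a * c j)) (E (\<eta> j))) h =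
      (\<Sum>i\<in>I. \<Sum>j\<in>J. \<psi> i (h * (t (\<theta> (a * c j)) * Y (\<eta> j) (b i))))"
    by (simp add: dual_act_def E_def mult.assoc) (rule sum.swap)
  also have "\<dots> = E (\<lambda>x. \<theta> (a * x)) h"
    by (simp add: E_def Y flip: psi_sum sum_distrib_left)
  finally show "(\<Sum>j\<in>J. dual_act t (\<theta> (a * c j)) (E (\<eta> j))) h = E (\<lambda>x. \<theta> (a * x)) h" .
qed

text \<open>Expanding \<open>a * c j\<close> in the dual basis and moving the coefficients across
  the tensor sign shifts the action of \<open>a\<close> from the first factors to the functionals:
  \<open>E (\<eta> l)\<close> becomes \<open>E\<close> of \<open>\<eta> l (a * x)\<close>. Only then
  does \<open>E_mult\<close> apply.\<close>

lemma normalized_invariant: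
  assumes J: "finite J" and c: "\<And>a. (\<Sum>j\<in>J. c j * t (\<eta> j a)) = a"
    and \<eta>: "\<And>j. dual_map (\<eta> j)"
  shows "\<exists>n\<in>invariants s\<^sub>L \<pi>\<^sub>L (integral_tensor s t \<gamma>\<^sub>R) (integral_tensor_act s t \<gamma>\<^sub>R).
    tensor_eval (\<lambda>x \<phi>. \<phi> x) n = 1"
proof
  let ?K = "tensor_null UNIV \<L> (via_right t) (dual_act t)"
  define X where "X = (\<Sum>j\<in>J. frag_of (c j, E (\<eta> j)))"
  let ?n = "coset ?K X"
  have E_L: "E (\<eta> j) \<in> \<L>" for j
    by (rule E_integral) (rule \<eta>)
  have "Poly_Mapping.keys X \<subseteq> UNIV \<times> \<L>"
    unfolding X_def by (rule order.trans[OF keys_sum]) (auto simp: E_L)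
  then have in_tensor: "?n \<in> integral_tensor s t \<gamma>\<^sub>R"
    by (auto simp: integral_tensor_def tensor_def)
  have act: "integral_tensor_act s t \<gamma>\<^sub>R a ?n =
      coset ?K (\<Sum>l\<in>J. frag_of (c l, E (\<lambda>x. \<eta> l (a * x))))" for a
  proof -
    let ?r = "\<lambda>l j. \<eta> l (a * c j)"
    let ?A = "\<Sum>j\<in>J. frag_of (a * c j, E (\<eta> j))"
      and ?B = "\<Sum>j\<in>J. \<Sum>l\<in>J. frag_of (via_right t (?r l j) (c l), E (\<eta> j))"
      and ?C = "\<Sum>j\<in>J. \<Sum>l\<in>J. frag_of (c l, dual_act t (?r l j) (E (\<eta> j)))"
      and ?D = "\<Sum>l\<in>J. frag_of (c l, \<Sum>j\<in>J. dual_act t (?r l j) (E (\<eta> j)))"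
    have "integral_tensor_act s t \<gamma>\<^sub>R a ?n = coset ?K ?A"
      using J by (simp add: integral_tensor_act_def tensor_map_coset_left distrib_left
          via_right_def mult.assoc X_def frag_extend_sum)
    also have "\<dots> = coset ?K ?B"
    proof (rule coset_tensor_eqI)
      have "frag_of (a * c j, E (\<eta> j)) - (\<Sum>l\<in>J. frag_of (via_right t (?r l j) (c l), E (\<eta> j))) \<in> ?K"
        for j
        using tensor_null_sum_left[OF E_L, where x = "\<lambda>l. via_right t (?r l j) (c l)" and J = J]
        by (simp add: via_right_def c)
      then show "?A - ?B \<in> ?K"
        unfolding sum_subtractf[symmetric] by (intro tensor_null_sum)
    qed
    also have "\<dots> = coset ?K ?C"
      by (rule coset_tensor_eqI, unfold sum_subtractf[symmetric],
          intro tensor_null_sum tensor_null_balance UNIV_I E_L)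
    also have "\<dots> = coset ?K ?D"
    proof (rule coset_tensor_eqI)
      have "frag_of (c l, \<Sum>j\<in>J. dual_act t (?r l j) (E (\<eta> j))) -
          (\<Sum>j\<in>J. frag_of (c l, dual_act t (?r l j) (E (\<eta> j)))) \<in> ?K" for l
        by (rule tensor_null_sum_right) (auto intro: integral_zero integral_plus integral_dual_act E_L)
      moreover have "?C = (\<Sum>l\<in>J. \<Sum>j\<in>J. frag_of (c l, dual_act t (?r l j) (E (\<eta> j))))"
        by (rule sum.swap)
      ultimately have "?D - ?C \<in> ?K"
        by (simp only: sum_subtractf[symmetric]) (intro tensor_null_sum)
      then have "- (?D - ?C) \<in> ?K"
        by (simp only: tensor_null_minus)
      then show "?C - ?D \<in> ?K"
        by (simp only: minus_diff_eq)
    qed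
    also have "?D = (\<Sum>l\<in>J. frag_of (c l, E (\<lambda>x. \<eta> l (a * x))))"
      by (simp add: E_dual_act[OF J c \<eta>])
    finally show ?thesis .
  qed
  have "integral_tensor_act s t \<gamma>\<^sub>R a ?n = integral_tensor_act s t \<gamma>\<^sub>R (s\<^sub>L (\<pi>\<^sub>L a)) ?n" for a
  proof -
    \<comment> \<open>Both sides are evaluated by \<open>E_mult\<close>, and
      \<open>\<epsilon> (t (\<omega> (\<epsilon> a))) = \<epsilon> a\<close>.\<close>
    have "E (\<lambda>x. \<eta> l (a * x)) = E (\<lambda>x. \<eta> l (t (\<omega> (\<epsilon> a)) * x))" for l
      by (rule ext) (simp add: E_mult[OF \<eta>])
    then show ?thesis
      by (simp only: act sL_piL)
  qed
  with in_tensor show "?n \<in> invariants s\<^sub>L \<pi>\<^sub>L (integral_tensor s t \<gamma>\<^sub>R) (integral_tensor_act s t \<gamma>\<^sub>R)"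
    by (simp add: invariants_def)
  have "tensor_eval (\<lambda>x \<phi>. \<phi> x) ?n = evalI (\<lambda>x \<phi>. \<phi> x) X"
    by (rule evalI_rep) (simp add: balI_def integral_add dual_act_def)
  then show "tensor_eval (\<lambda>x \<phi>. \<phi> x) ?n = 1"
    by (simp add: evalI_def X_def frag_eval_sum E_dual_basis[OF J c \<eta>])
qed

end

end

end

theorem proposition4p6:
  fixes scA :: "'k::{comm_ring,comm_monoid_mult} \<Rightarrow> 'a::{ring,monoid_mult} \<Rightarrow> 'a"
    and scL :: "'k \<Rightarrow> 'l::{ring,monoid_mult} \<Rightarrow> 'l"
    and scR :: "'k \<Rightarrow> 'r::{ring,monoid_mult} \<Rightarrow> 'r"
    and s\<^sub>L t\<^sub>L :: "'l \<Rightarrow> 'a"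
    and s\<^sub>R t\<^sub>R :: "'r \<Rightarrow> 'a"
    and \<gamma>\<^sub>L \<gamma>\<^sub>R :: "'a \<Rightarrow> ('a \<times> 'a \<Rightarrow>\<^sub>0 int) set"
    and \<pi>\<^sub>L :: "'a \<Rightarrow> 'l"
    and \<pi>\<^sub>R :: "'a \<Rightarrow> 'r"
    and S :: "'a \<Rightarrow> 'a"
  assumes "hopf_algebroid scA scL s\<^sub>L t\<^sub>L \<gamma>\<^sub>L \<pi>\<^sub>L scR s\<^sub>R t\<^sub>R \<gamma>\<^sub>R \<pi>\<^sub>R S"
    and "fg_projective_right (via_right s\<^sub>R)"
    and "fg_projective_left (via_right t\<^sub>R)"
    and "fg_projective_left (via_left s\<^sub>L)"
    and "fg_projective_right (via_left t\<^sub>L)"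
  shows "bij S \<longleftrightarrow>
    (\<exists>n \<in> invariants s\<^sub>L \<pi>\<^sub>L (integral_tensor s\<^sub>R t\<^sub>R \<gamma>\<^sub>R) (integral_tensor_act s\<^sub>R t\<^sub>R \<gamma>\<^sub>R).
       tensor_eval (\<lambda>x \<phi>. \<phi> x) n = 1)"
proof
  interpret hopf_algebroid scA scL s\<^sub>L t\<^sub>L \<gamma>\<^sub>L \<pi>\<^sub>L scR s\<^sub>R t\<^sub>R \<gamma>\<^sub>R \<pi>\<^sub>R S
    by (rule assms(1))
  let ?exists = "\<exists>n \<in> invariants s\<^sub>L \<pi>\<^sub>L (integral_tensor s\<^sub>R t\<^sub>R \<gamma>\<^sub>R)
      (integral_tensor_act s\<^sub>R t\<^sub>R \<gamma>\<^sub>R). tensor_eval (\<lambda>x \<phi>. \<phi> x) n = 1"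
  show "bij S" if ?exists
    using that bij_S_of_invariant by blast
  show ?exists if "bij S"
  proof -
    obtain I :: "'a set" and b \<beta> where I: "finite I" "\<forall>a. (\<Sum>i\<in>I. via_right s\<^sub>R (\<beta> i a) (b i)) = a"
        "\<forall>i a a'. \<beta> i (a + a') = \<beta> i a + \<beta> i a'"
        "\<forall>i r a. \<beta> i (via_right s\<^sub>R r a) = \<beta> i a * r"
      using dual_basis[of "via_right s\<^sub>R" "\<lambda>r x. x * r"] assms(2)
      unfolding fg_projective_right_def by simp (elim exE conjE, rule that)
    obtain J :: "'a set" and c \<eta> where J: "finite J" "\<forall>a. (\<Sum>j\<in>J. via_right t\<^sub>R (\<eta> j a) (c j)) = a"
        "\<forall>j a a'. \<eta> j (a + a') = \<eta> j a + \<eta> j a'"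
        "\<forall>j r a. \<eta> j (via_right t\<^sub>R r a) = r * \<eta> j a"
      using dual_basis[of "via_right t\<^sub>R" "\<lambda>r x. r * x"] assms(3)
      unfolding fg_projective_left_def by simp (elim exE conjE, rule that)
    show ?thesis
      using I J
      by (intro normalized_invariant[OF \<open>bij S\<close>, of I b \<beta> J c \<eta>])
        (simp_all add: via_right_def dual_map_def)
  qed
qed

end
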